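(* Let $d\ge1$, $0<\alpha<2$, and let $\{X_t\}_{t\in\mathbb{Z}^d}$ be a stationary $S\alpha S$ random field with integral representation $X_t\stackrel{d}{=}\int_Sf_t\,dM$, where $$f_t(s)=c_t(s)\Big(\frac{d\mu\circ\phi_t}{d\mu}(s)\Big)^{1/\alpha} f\circ\phi_t(s),\qquad t\in\mathbb{Z}^d,$$ $f\in L^\alpha(S,\mu)$, $\{\phi_t\}_{t\in\mathbb{Z}^d}$ is a nonsingular $\mathbb{Z}^d$-action on $(S,\mu)$, $\{c_t\}$ is a measurable $\{-1,+1\}$-valued cocycle for $\{\phi_t\}$, and $\mathrm{Support}(f_t,t\in\mathbb{Z}^d)=S$. Let $$b_n=\Big(\int_S\max_{0\le t\le(n-1)\mathbf 1}|f_t(s)|^\alpha\,\mu(ds)\Big)^{1/\alpha},\qquad n\ge1,$$ and let the subgroup $F\subseteq\mathbb{Z}^d$ and its rank $p\ge1$ be associated with $\{\phi_t\}$ as described in the context. 1. If $\{\phi_t\}_{t\in F}$ is conservative, then $n^{-p/\alpha}b_n\to0$. 2. If $\{\phi_t\}_{t\in F}$ is dissipative, then $n^{-p/\alpha}b_n\to a$ for some $a\in(0,\infty)$.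
   Context: A random field $\{X_t\}_{t\in\mathbb{Z}^d}$ is $S\alpha S$ (symmetric $\alpha$-stable) if every finite real linear combination $\sum_j c_jX_{t_j}$ has a symmetric $\alpha$-stable distribution; it is stationary if $\{X_t\}\stackrel{d}{=}\{X_{t+s}\}$ for all $s\in\mathbb{Z}^d$. Random fields are assumed non-Gaussian throughout (in particular not identically zero). Integral representation: $\{X_t\}\stackrel{d}{=}\{\int_S f_t\,dM\}$ (equality of finite-dimensional distributions), where $(S,\mathcal S)$ is a standard Borel space, $\mu$ is a $\sigma$-finite measure on it, $f_t\in L^\alpha(S,\mu)$ are real-valued, and $M$ is an $S\alpha S$ random measure with control measure $\mu$, i.e. an independently scattered random measure with $E\exp(i\theta\int f\,dM)=\exp(-|\theta|^\alpha\int|f|^\alpha d\mu)$ for $f\in L^\alpha(\mu)$. $\mathrm{Support}(f_t,t\in\mathbb{Z}^d)=S$ means $\bigcup_t\{f_t\ne0\}=S$ up to a $\mu$-null set. For $u,v\in\mathbb{Z}^d$, $u\le v$ is meant coordinatewise, and $\mathbf 1=(1,\dots,1)$. For a countable abelian group $G$, an action $\{\phi_t\}_{t\in G}$ on $S$ is a family of measurable maps $\phi_t:S\to S$ with $\phi_0=\mathrm{id}$, $\phi_{u+v}=\phi_u\circ\phi_v$; it is nonsingular if $\mu\circ\phi_t\sim\mu$ for all $t$. A $\{-1,+1\}$-valued cocycle is a family of measurable maps $c_t:S\to\{-1,+1\}$ such that for all $u,v$, $c_{u+v}(s)=c_v(s)c_u(\phi_v(s))$ for $\mu$-a.a. $s$.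 A set $W_*\in\mathcal S$ is wandering if the sets $\phi_t(W_* )$, $t\in G$, are pairwise disjoint. The action is conservative if there is no wandering set of positive $\mu$-measure, and dissipative if $S=\bigcup_{t\in G}\phi_t(W_* )$ (mod $\mu$) for some wandering set $W_*$. For $\{\phi_t\}_{t\in F}$ these notions are taken with $G=F$. Group-theoretic setting: let $A=\{\phi_t:t\in\mathbb{Z}^d\}$, a subgroup of the group of invertible nonsingular transformations of $(S,\mu)$ (maps identified mod $\mu$), let $\Phi:\mathbb{Z}^d\to A$, $\Phi(t)=\phi_t$, and $K=\mathrm{Ker}(\Phi)=\{t\in\mathbb{Z}^d:\phi_t=1_S\}$. Then $A\simeq\mathbb{Z}^d/K$ and $A=\bar F\oplus\bar N$ with $\bar F$ a free abelian group and $\bar N$ a finite group. Assume $p:=\mathrm{rank}(\bar F)\ge1$. As $\bar F$ is free there is an injective homomorphism $\Psi:\bar F\to\mathbb{Z}^d$ with $\Phi\circ\Psi=1_{\bar F}$. Put $F=\Psi(\bar F)$, a free subgroup of $\mathbb{Z}^d$ of rank $p$. *)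

theory Defs
  imports "HOL-Probability.Probability" "HOL-Algebra.Free_Abelian_Groups"
begin

section \<open>Random fields\<close>

definition random_field :: "'w measure \<Rightarrow> ('i \<Rightarrow> 'w \<Rightarrow> real) \<Rightarrow> bool" where
  "random_field P X \<longleftrightarrow> prob_space P \<and> (\<forall>t. X t \<in> borel_measurable P)"

definition same_fdd ::
    "'w measure \<Rightarrow> ('i \<Rightarrow> 'w \<Rightarrow> real) \<Rightarrow> 'v measure \<Rightarrow> ('i \<Rightarrow> 'v \<Rightarrow> real) \<Rightarrow> bool" where
  "same_fdd P X Q Y \<longleftrightarrow>
     (\<forall>J. finite J \<longrightarrow>
        distr P (Pi\<^sub>M J (\<lambda>_. borel)) (\<lambda>\<omega>. \<lambda>t\<in>J. X t \<omega>) =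
        distr Q (Pi\<^sub>M J (\<lambda>_. borel)) (\<lambda>\<omega>. \<lambda>t\<in>J. Y t \<omega>))"

definition stationary_field :: "'w measure \<Rightarrow> ('i::ab_group_add \<Rightarrow> 'w \<Rightarrow> real) \<Rightarrow> bool" where
  "stationary_field P X \<longleftrightarrow> (\<forall>s. same_fdd P X P (\<lambda>t. X (t + s)))"

text \<open>Symmetric \<open>\<alpha>\<close>-stable law with scale \<open>\<sigma>\<close>; the degenerate case \<open>\<sigma> = 0\<close> is allowed.\<close>

definition sas_variable :: "'w measure \<Rightarrow> real \<Rightarrow> ('w \<Rightarrow> real) \<Rightarrow> bool" where
  "sas_variable P \<alpha> Y \<longleftrightarrow>
     Y \<in> borel_measurable P \<and>
     (\<exists>\<sigma>\<ge>0. \<forall>\<theta>. char (distr P borel Y) \<theta> =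
        complex_of_real (exp (- (\<sigma> powr \<alpha> * \<bar>\<theta>\<bar> powr \<alpha>))))"

definition sas_field :: "'w measure \<Rightarrow> real \<Rightarrow> ('i \<Rightarrow> 'w \<Rightarrow> real) \<Rightarrow> bool" where
  "sas_field P \<alpha> X \<longleftrightarrow>
     random_field P X \<and>
     (\<forall>J a. finite J \<longrightarrow> sas_variable P \<alpha> (\<lambda>\<omega>. \<Sum>t\<in>J. a t * X t \<omega>))"

text \<open>Constants count as Gaussian, so a non-Gaussian field is in particular not identically zero.\<close>

definition gaussian_variable :: "'w measure \<Rightarrow> ('w \<Rightarrow> real) \<Rightarrow> bool" where
  "gaussian_variable P Y \<longleftrightarrow>
     (\<exists>m. AE \<omega> in P. Y \<omega> = m) \<or>
     (\<exists>m \<sigma>. 0 < \<sigma> \<and> distributed P lborel Y (\<lambda>x. ennreal (normal_density m \<sigma> x)))"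

definition gaussian_field :: "'w measure \<Rightarrow> ('i \<Rightarrow> 'w \<Rightarrow> real) \<Rightarrow> bool" where
  "gaussian_field P X \<longleftrightarrow>
     random_field P X \<and>
     (\<forall>J a. finite J \<longrightarrow> gaussian_variable P (\<lambda>\<omega>. \<Sum>t\<in>J. a t * X t \<omega>))"


section \<open>Stable random measures and their integrals\<close>

definition standard_borel_space :: "'s measure \<Rightarrow> bool" where
  "standard_borel_space \<mu> \<longleftrightarrow>
     (\<exists>T. completely_metrizable_space T \<and> second_countable T \<and> topspace T = space \<mu> \<and>
          sets \<mu> = sigma_sets (space \<mu>) {U. openin T U})"

definition Lalpha :: "'s measure \<Rightarrow> real \<Rightarrow> ('s \<Rightarrow> real) set" where
  "Lalpha \<mu> \<alpha> = {f \<in> borel_measurable \<mu>. integrable \<mu> (\<lambda>s. \<bar>f s\<bar> powr \<alpha>)}"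

definition finite_sets :: "'s measure \<Rightarrow> 's set set" where
  "finite_sets \<mu> = {A \<in> sets \<mu>. emeasure \<mu> A < \<infinity>}"

definition independently_scattered ::
    "'v measure \<Rightarrow> 's measure \<Rightarrow> ('s set \<Rightarrow> 'v \<Rightarrow> real) \<Rightarrow> bool" where
  "independently_scattered Q \<mu> M \<longleftrightarrow>
     prob_space Q \<and>
     (\<forall>A\<in>finite_sets \<mu>. M A \<in> borel_measurable Q) \<and>
     (\<forall>A :: nat \<Rightarrow> 's set. range A \<subseteq> finite_sets \<mu> \<and> disjoint_family A \<longrightarrow>
        prob_space.indep_vars Q (\<lambda>_. borel) (\<lambda>i. M (A i)) UNIV) \<and>
     (\<forall>A :: nat \<Rightarrow> 's set. range A \<subseteq> finite_sets \<mu> \<and> disjoint_family A \<and>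
        (\<Union>i. A i) \<in> finite_sets \<mu> \<longrightarrow>
        (AE \<omega> in Q. (\<lambda>i. M (A i) \<omega>) sums M (\<Union>i. A i) \<omega>))"

text \<open>
  The integral of a simple function vanishing off a set of finite measure is the obvious finite
  sum over its level sets (the value \<open>0\<close> must be left out, as its level set may have infinite
  measure). It extends to \<open>L\<^sup>\<alpha>\<close> by approximating in \<open>L\<^sup>\<alpha>\<close> and passing to the limit in probability,
  so the integral is determined up to almost sure equality.
\<close>

definition simple_stoch_integral ::
    "'s measure \<Rightarrow> ('s set \<Rightarrow> 'v \<Rightarrow> real) \<Rightarrow> ('s \<Rightarrow> real) \<Rightarrow> 'v \<Rightarrow> real" where
  "simple_stoch_integral \<mu> M g \<omega> =
     (\<Sum>y\<in>g ` space \<mu> - {0}. y * M (g -` {y} \<inter> space \<mu>) \<omega>)"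

definition has_stoch_integral ::
    "'v measure \<Rightarrow> 's measure \<Rightarrow> real \<Rightarrow> ('s set \<Rightarrow> 'v \<Rightarrow> real) \<Rightarrow>
     ('s \<Rightarrow> real) \<Rightarrow> ('v \<Rightarrow> real) \<Rightarrow> bool" where
  "has_stoch_integral Q \<mu> \<alpha> M f Y \<longleftrightarrow>
     f \<in> Lalpha \<mu> \<alpha> \<and> Y \<in> borel_measurable Q \<and>
     (\<exists>g :: nat \<Rightarrow> 's \<Rightarrow> real.
        (\<forall>n. simple_function \<mu> (g n) \<and> emeasure \<mu> {s \<in> space \<mu>. g n s \<noteq> 0} < \<infinity>) \<and>
        (\<lambda>n. \<integral>s. \<bar>g n s - f s\<bar> powr \<alpha> \<partial>\<mu>) \<longlonglongrightarrow> 0 \<and>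
        (\<forall>\<epsilon>>0. (\<lambda>n. measure Q {\<omega> \<in> space Q. \<bar>simple_stoch_integral \<mu> M (g n) \<omega> - Y \<omega>\<bar> > \<epsilon>})
                   \<longlonglongrightarrow> 0))"

definition sas_random_measure ::
    "'v measure \<Rightarrow> 's measure \<Rightarrow> real \<Rightarrow> ('s set \<Rightarrow> 'v \<Rightarrow> real) \<Rightarrow> bool" where
  "sas_random_measure Q \<mu> \<alpha> M \<longleftrightarrow>
     independently_scattered Q \<mu> M \<and>
     (\<forall>f Y \<theta>. has_stoch_integral Q \<mu> \<alpha> M f Y \<longrightarrow>
        char (distr Q borel Y) \<theta> =
        complex_of_real (exp (- (\<bar>\<theta>\<bar> powr \<alpha> * (\<integral>s. \<bar>f s\<bar> powr \<alpha> \<partial>\<mu>)))))"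

definition integral_representation ::
    "'w measure \<Rightarrow> ('i \<Rightarrow> 'w \<Rightarrow> real) \<Rightarrow> 'v measure \<Rightarrow> ('s set \<Rightarrow> 'v \<Rightarrow> real) \<Rightarrow>
     's measure \<Rightarrow> real \<Rightarrow> ('i \<Rightarrow> 's \<Rightarrow> real) \<Rightarrow> bool" where
  "integral_representation P X Q M \<mu> \<alpha> f \<longleftrightarrow>
     standard_borel_space \<mu> \<and> sigma_finite_measure \<mu> \<and>
     (\<forall>t. f t \<in> Lalpha \<mu> \<alpha>) \<and> sas_random_measure Q \<mu> \<alpha> M \<and>
     (\<exists>Y. (\<forall>t. has_stoch_integral Q \<mu> \<alpha> M (f t) (Y t)) \<and> same_fdd P X Q Y)"

definition full_support :: "'s measure \<Rightarrow> ('i \<Rightarrow> 's \<Rightarrow> real) \<Rightarrow> bool" where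
  "full_support \<mu> f \<longleftrightarrow> (AE s in \<mu>. \<exists>t. f t s \<noteq> 0)"


section \<open>Nonsingular actions\<close>

text \<open>The measure \<open>\<mu> \<circ> \<psi>\<close>, i.e. \<open>A \<mapsto> \<mu> (\<psi> ` A)\<close>, for an invertible \<open>\<psi>\<close>.\<close>

definition meas_comp :: "'s measure \<Rightarrow> ('s \<Rightarrow> 's) \<Rightarrow> 's measure" where
  "meas_comp \<mu> \<psi> = measure_of (space \<mu>) (sets \<mu>) (\<lambda>A. emeasure \<mu> (\<psi> ` A))"

definition measurable_action :: "'s measure \<Rightarrow> ('g::ab_group_add \<Rightarrow> 's \<Rightarrow> 's) \<Rightarrow> bool" where
  "measurable_action \<mu> \<phi> \<longleftrightarrow>
     (\<forall>t. \<phi> t \<in> measurable \<mu> \<mu>) \<and>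
     (\<forall>s\<in>space \<mu>. \<phi> 0 s = s) \<and>
     (\<forall>u v. \<forall>s\<in>space \<mu>. \<phi> (u + v) s = \<phi> u (\<phi> v s))"

definition nonsingular_action :: "'s measure \<Rightarrow> ('g::ab_group_add \<Rightarrow> 's \<Rightarrow> 's) \<Rightarrow> bool" where
  "nonsingular_action \<mu> \<phi> \<longleftrightarrow>
     measurable_action \<mu> \<phi> \<and>
     (\<forall>t. absolutely_continuous \<mu> (meas_comp \<mu> (\<phi> t)) \<and>
          absolutely_continuous (meas_comp \<mu> (\<phi> t)) \<mu>)"

definition sign_cocycle ::
    "'s measure \<Rightarrow> ('g::ab_group_add \<Rightarrow> 's \<Rightarrow> 's) \<Rightarrow> ('g \<Rightarrow> 's \<Rightarrow> real) \<Rightarrow> bool" where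
  "sign_cocycle \<mu> \<phi> c \<longleftrightarrow>
     (\<forall>t. c t \<in> borel_measurable \<mu> \<and> (\<forall>s\<in>space \<mu>. c t s \<in> {-1, 1})) \<and>
     (\<forall>u v. AE s in \<mu>. c (u + v) s = c v s * c u (\<phi> v s))"

definition wandering :: "'s measure \<Rightarrow> ('g \<Rightarrow> 's \<Rightarrow> 's) \<Rightarrow> 'g set \<Rightarrow> 's set \<Rightarrow> bool" where
  "wandering \<mu> \<phi> G W \<longleftrightarrow> W \<in> sets \<mu> \<and> disjoint_family_on (\<lambda>t. \<phi> t ` W) G"

definition conservative :: "'s measure \<Rightarrow> ('g \<Rightarrow> 's \<Rightarrow> 's) \<Rightarrow> 'g set \<Rightarrow> bool" where
  "conservative \<mu> \<phi> G \<longleftrightarrow> \<not> (\<exists>W. wandering \<mu> \<phi> G W \<and> emeasure \<mu> W > 0)"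

definition dissipative :: "'s measure \<Rightarrow> ('g \<Rightarrow> 's \<Rightarrow> 's) \<Rightarrow> 'g set \<Rightarrow> bool" where
  "dissipative \<mu> \<phi> G \<longleftrightarrow> (\<exists>W. wandering \<mu> \<phi> G W \<and> (AE s in \<mu>. s \<in> (\<Union>t\<in>G. \<phi> t ` W)))"

definition action_kernel ::
    "'s measure \<Rightarrow> real \<Rightarrow> ('g \<Rightarrow> 's \<Rightarrow> 's) \<Rightarrow> ('g \<Rightarrow> 's \<Rightarrow> real) \<Rightarrow>
     ('s \<Rightarrow> real) \<Rightarrow> 'g \<Rightarrow> 's \<Rightarrow> real" where
  "action_kernel \<mu> \<alpha> \<phi> c f t s =
     c t s * enn2real (RN_deriv \<mu> (meas_comp \<mu> (\<phi> t)) s) powr (1 / \<alpha>) * f (\<phi> t s)"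

definition max_scale :: "'s measure \<Rightarrow> real \<Rightarrow> (int ^ 'd \<Rightarrow> 's \<Rightarrow> real) \<Rightarrow> nat \<Rightarrow> real" where
  "max_scale \<mu> \<alpha> f n =
     (\<integral>s. (MAX t\<in>{0..(\<chi> i. int n - 1)}. \<bar>f t s\<bar> powr \<alpha>) \<partial>\<mu>) powr (1 / \<alpha>)"


section \<open>The group of transformations generated by an action\<close>

text \<open>
  Transformations are identified mod \<open>\<mu>\<close>: elements of the group are classes of almost everywhere
  equal maps, and invertibility is also understood mod \<open>\<mu>\<close>.
\<close>

definition nonsingular_transformations :: "'s measure \<Rightarrow> ('s \<Rightarrow> 's) set" where
  "nonsingular_transformations \<mu> =
     {\<psi> \<in> measurable \<mu> \<mu>. null_sets (distr \<mu> \<mu> \<psi>) = null_sets \<mu> \<and>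
        (\<exists>\<eta>\<in>measurable \<mu> \<mu>. (AE s in \<mu>. \<eta> (\<psi> s) = s) \<and> (AE s in \<mu>. \<psi> (\<eta> s) = s))}"

definition ae_class :: "'s measure \<Rightarrow> ('s \<Rightarrow> 's) \<Rightarrow> ('s \<Rightarrow> 's) set" where
  "ae_class \<mu> \<psi> = {\<eta> \<in> measurable \<mu> \<mu>. AE s in \<mu>. \<eta> s = \<psi> s}"

definition transformation_group :: "'s measure \<Rightarrow> ('s \<Rightarrow> 's) set monoid" where
  "transformation_group \<mu> =
     \<lparr>carrier = ae_class \<mu> ` nonsingular_transformations \<mu>,
      monoid.mult = (\<lambda>C D. \<Union>\<psi>\<in>C. \<Union>\<eta>\<in>D. ae_class \<mu> (\<psi> \<circ> \<eta>)),
      one = ae_class \<mu> (\<lambda>s. s)\<rparr>"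

definition action_group :: "'s measure \<Rightarrow> ('g \<Rightarrow> 's \<Rightarrow> 's) \<Rightarrow> ('s \<Rightarrow> 's) set monoid" where
  "action_group \<mu> \<phi> =
     (transformation_group \<mu>)\<lparr>carrier := range (\<lambda>t. ae_class \<mu> (\<phi> t))\<rparr>"

definition additive_group :: "'g::ab_group_add monoid" where
  "additive_group = \<lparr>carrier = UNIV, monoid.mult = (+), one = 0\<rparr>"

definition free_abelian_of_rank :: "('a, 'b) monoid_scheme \<Rightarrow> nat \<Rightarrow> bool" where
  "free_abelian_of_rank G p \<longleftrightarrow> G \<cong> free_Abelian_group {..<p}"

definition internal_direct_sum ::
    "('a, 'b) monoid_scheme \<Rightarrow> 'a set \<Rightarrow> 'a set \<Rightarrow> bool" where
  "internal_direct_sum G H N \<longleftrightarrow>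
     subgroup H G \<and> subgroup N G \<and> H \<inter> N = {\<one>\<^bsub>G\<^esub>} \<and> H <#>\<^bsub>G\<^esub> N = carrier G"

text \<open>
  \<open>F\<close> is the image under a homomorphic section \<open>\<Psi>\<close> of \<open>\<Phi>\<close> of the free part of the group of
  transformations \<open>\<phi>\<^sub>t\<close>, and \<open>p\<close> is its rank. Since \<open>F\<close> depends on the choice of the decomposition
  and of \<open>\<Psi>\<close>, this is a relation rather than a function of \<open>\<phi>\<close>.
\<close>

definition effective_free_subgroup ::
    "'s measure \<Rightarrow> ('g::ab_group_add \<Rightarrow> 's \<Rightarrow> 's) \<Rightarrow> 'g set \<Rightarrow> nat \<Rightarrow> bool" where
  "effective_free_subgroup \<mu> \<phi> F p \<longleftrightarrow>
     (\<exists>Fbar Nbar \<Psi>.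
        internal_direct_sum (action_group \<mu> \<phi>) Fbar Nbar \<and>
        free_abelian_of_rank ((action_group \<mu> \<phi>)\<lparr>carrier := Fbar\<rparr>) p \<and>
        finite Nbar \<and>
        \<Psi> \<in> hom ((action_group \<mu> \<phi>)\<lparr>carrier := Fbar\<rparr>) additive_group \<and>
        inj_on \<Psi> Fbar \<and>
        (\<forall>C\<in>Fbar. ae_class \<mu> (\<phi> (\<Psi> C)) = C) \<and>
        F = \<Psi> ` Fbar)"


section \<open>Basic facts\<close>

lemma measurable_action_inverse:
  assumes "measurable_action \<mu> \<phi>" "s \<in> space \<mu>"
  shows "\<phi> t s \<in> space \<mu>" "\<phi> (- t) (\<phi> t s) = s" "\<phi> t (\<phi> (- t) s) = s"
proof -
  show "\<phi> t s \<in> space \<mu>"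
    using assms unfolding measurable_action_def by (meson measurable_space)
  have "\<phi> (- t + t) s = \<phi> (- t) (\<phi> t s)" "\<phi> (t + - t) s = \<phi> t (\<phi> (- t) s)"
    using assms unfolding measurable_action_def by blast+
  then show "\<phi> (- t) (\<phi> t s) = s" "\<phi> t (\<phi> (- t) s) = s"
    using assms unfolding measurable_action_def by simp_all
qed

lemma action_image_eq_vimage:
  assumes "measurable_action \<mu> \<phi>" "A \<subseteq> space \<mu>"
  shows "\<phi> t ` A = \<phi> (- t) -` A \<inter> space \<mu>"
proof (intro Set.set_eqI iffI)
  fix s assume "s \<in> \<phi> t ` A"
  then obtain r where "r \<in> A" "s = \<phi> t r" by blast
  then show "s \<in> \<phi> (- t) -` A \<inter> space \<mu>"
    using assms measurable_action_inverse[OF assms(1)] by auto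
next
  fix s assume "s \<in> \<phi> (- t) -` A \<inter> space \<mu>"
  then have "\<phi> (- t) s \<in> A" "\<phi> t (\<phi> (- t) s) = s"
    using measurable_action_inverse[OF assms(1)] by auto
  then show "s \<in> \<phi> t ` A" by (metis imageI)
qed

lemma meas_comp_eq_distr:
  assumes "measurable_action \<mu> \<phi>"
  shows "meas_comp \<mu> (\<phi> t) = distr \<mu> \<mu> (\<phi> (- t))"
proof -
  have "measure_of (space \<mu>) (sets \<mu>) (\<lambda>A. emeasure \<mu> (\<phi> t ` A)) =
        measure_of (space \<mu>) (sets \<mu>) (\<lambda>A. emeasure \<mu> (\<phi> (- t) -` A \<inter> space \<mu>))"
    by (rule measure_of_eq[OF sets.space_closed])
       (simp add: sets.sigma_sets_eq action_image_eq_vimage[OF assms sets.sets_into_space])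
  then show ?thesis by (simp add: meas_comp_def distr_def)
qed

lemma nonsingular_action_null_sets:
  assumes "nonsingular_action \<mu> \<phi>"
  shows "null_sets (distr \<mu> \<mu> (\<phi> t)) = null_sets \<mu>"
  using assms meas_comp_eq_distr[of \<mu> \<phi> "- t"]
  unfolding nonsingular_action_def absolutely_continuous_def
  by (metis minus_minus subset_antisym)

lemma nonsingular_action_transformation:
  assumes "nonsingular_action \<mu> \<phi>"
  shows "\<phi> t \<in> nonsingular_transformations \<mu>"
proof -
  have act: "measurable_action \<mu> \<phi>" using assms by (simp add: nonsingular_action_def)
  have meas: "\<phi> u \<in> measurable \<mu> \<mu>" for u using act by (simp add: measurable_action_def)
  have "AE s in \<mu>. \<phi> (- t) (\<phi> t s) = s" "AE s in \<mu>. \<phi> t (\<phi> (- t) s) = s"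
    using measurable_action_inverse[OF act] by (auto intro!: AE_I2)
  with meas nonsingular_action_null_sets[OF assms] show ?thesis
    unfolding nonsingular_transformations_def by blast
qed

lemma ae_class_cong:
  assumes "AE s in \<mu>. \<psi> s = \<eta> s"
  shows "ae_class \<mu> \<psi> = ae_class \<mu> \<eta>"
proof -
  have "(AE s in \<mu>. \<xi> s = \<psi> s) \<longleftrightarrow> (AE s in \<mu>. \<xi> s = \<eta> s)" for \<xi>
    by (rule eventually_cong[OF assms]) simp
  then show ?thesis by (simp add: ae_class_def)
qed

lemma AE_nonsingular_compose:
  assumes "\<phi> \<in> measurable \<mu> \<mu>" "null_sets (distr \<mu> \<mu> \<phi>) = null_sets \<mu>" "AE s in \<mu>. R s"
  shows "AE s in \<mu>. R (\<phi> s)"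
proof -
  obtain N where N: "N \<in> null_sets \<mu>" "{s \<in> space \<mu>. \<not> R s} \<subseteq> N"
    using assms(3) unfolding eventually_ae_filter by blast
  have "N \<in> null_sets (distr \<mu> \<mu> \<phi>)" using N(1) assms(2) by simp
  then have "\<phi> -` N \<inter> space \<mu> \<in> null_sets \<mu>"
    using assms(1) by (auto simp: null_sets_def emeasure_distr measurable_sets)
  moreover have "{s \<in> space \<mu>. \<not> R (\<phi> s)} \<subseteq> \<phi> -` N \<inter> space \<mu>"
    using N(2) assms(1) by (auto dest: measurable_space)
  ultimately show ?thesis unfolding eventually_ae_filter by blast
qed

lemma action_group_mult:
  assumes "nonsingular_action \<mu> \<phi>"
  shows "ae_class \<mu> (\<phi> u) \<otimes>\<^bsub>action_group \<mu> \<phi>\<^esub> ae_class \<mu> (\<phi> v) = ae_class \<mu> (\<phi> (u + v))"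
proof -
  have act: "measurable_action \<mu> \<phi>" using assms by (simp add: nonsingular_action_def)
  have meas: "\<phi> t \<in> measurable \<mu> \<mu>" for t using act by (simp add: measurable_action_def)
  have "ae_class \<mu> (\<psi> \<circ> \<eta>) = ae_class \<mu> (\<phi> (u + v))"
    if "\<psi> \<in> ae_class \<mu> (\<phi> u)" "\<eta> \<in> ae_class \<mu> (\<phi> v)" for \<psi> \<eta>
  proof (rule ae_class_cong)
    have 1: "AE s in \<mu>. \<psi> (\<phi> v s) = \<phi> u (\<phi> v s)"
      using AE_nonsingular_compose[OF meas nonsingular_action_null_sets[OF assms]] that(1)
      unfolding ae_class_def by blast
    have 2: "AE s in \<mu>. \<eta> s = \<phi> v s" using that(2) by (simp add: ae_class_def)
    have 3: "AE s in \<mu>. \<phi> (u + v) s = \<phi> u (\<phi> v s)"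
      using act by (auto simp: measurable_action_def intro!: AE_I2)
    show "AE s in \<mu>. (\<psi> \<circ> \<eta>) s = \<phi> (u + v) s"
      using 1 2 3 by eventually_elim simp
  qed
  moreover have "\<phi> t \<in> ae_class \<mu> (\<phi> t)" for t
    using meas by (simp add: ae_class_def)
  ultimately show ?thesis
    unfolding action_group_def transformation_group_def by simp blast
qed

end

theory Submission
  imports Defs
begin

text \<open>
  Put \<open>G\<^sub>t = \<bar>f\<^sub>t\<bar> powr \<alpha>\<close>, i.e. \<open>g = \<bar>f\<bar> powr \<alpha>\<close> transported by \<open>\<phi>\<^sub>t\<close>. It depends only on the class of \<open>t\<close>
  modulo the kernel. Writing the maximum over a finite set of classes as a sum over the indices that
  attain it, and moving each term back by \<open>\<phi>\<^sub>t\<close>, turns the integral of the maximum over the box into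
  a sum over \<open>t\<close> of integrals of \<open>g \<cdot> \<kappa>\<close>, where \<open>\<kappa>\<close> records whether \<open>g\<close> dominates the \<open>G\<^sub>r\<close> with \<open>r + t\<close> in
  the box. As the images of the boxes in the quotient group form a Folner sequence, dividing by the number
  of classes gives a limit \<open>J\<close>, the integral of \<open>g \<cdot> \<kappa>\<close> with \<open>\<kappa>\<close> taken over the whole group.
  The number of classes met by the box of side \<open>n\<close> is eventually a polynomial in \<open>n\<close> (Khovanskii), of
  degree \<open>p\<close>, which provides both the Folner property and the normalisation \<open>n powr p\<close>.
  If \<open>J > 0\<close>, then \<open>F\<close> has a wandering set of positive measure among the points where \<open>g\<close> is
  maximal along its orbit; if \<open>F\<close> is dissipative, then \<open>G\<close> is summable along almost every orbit,
  so the maximum is attained finitely often and \<open>J > 0\<close>.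
\<close>

section \<open>Counting classes of lattice points in boxes\<close>

text \<open>A monotone subsequence always exists. If it decreases, it is constant from an index of
  its minimum on, and that tail serves instead.\<close>

lemma ex_mono_subseq_nat:
  fixes s :: "nat \<Rightarrow> nat"
  shows "\<exists>r :: nat \<Rightarrow> nat. strict_mono r \<and> mono (\<lambda>n. s (r n))"
proof -
  obtain r :: "nat \<Rightarrow> nat" where r: "strict_mono r" "monoseq (\<lambda>n. s (r n))"
    using seq_monosub by blast
  from r(2) consider "incseq (\<lambda>n. s (r n))" | "decseq (\<lambda>n. s (r n))"
    by (auto simp: monoseq_iff)
  then show ?thesis
  proof cases
    case 1
    then show ?thesis using r(1) by (intro exI[of _ r]) (simp add: mono_def incseq_def)
  next
    case 2
    obtain N where N: "\<And>n. s (r N) \<le> s (r n)"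
      using ex_has_least_nat[of "\<lambda>_. True" _ "\<lambda>n. s (r n)"] by auto
    have "s (r (N + n)) = s (r N)" for n
      using N[of "N + n"] decseqD[OF 2, of N "N + n"] by simp
    moreover have "strict_mono (\<lambda>n. r (N + n))"
      using r(1) by (simp add: strict_mono_def)
    ultimately show ?thesis by (intro exI[of _ "\<lambda>n. r (N + n)"]) (simp add: mono_def)
  qed
qed

lemma ex_mono_subseq_fun:
  fixes s :: "nat \<Rightarrow> 'a \<Rightarrow> nat"
  assumes "finite A"
  shows "\<exists>r :: nat \<Rightarrow> nat. strict_mono r \<and> (\<forall>i\<in>A. mono (\<lambda>n. s (r n) i))"
  using assms
proof induction
  case empty
  show ?case by (intro exI[of _ id]) (simp add: strict_mono_def)
next
  case (insert a A)
  then obtain r :: "nat \<Rightarrow> nat" where r: "strict_mono r" "\<forall>i\<in>A. mono (\<lambda>n. s (r n) i)" by blast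
  obtain q :: "nat \<Rightarrow> nat" where q: "strict_mono q" "mono (\<lambda>n. s (r (q n)) a)"
    using ex_mono_subseq_nat[of "\<lambda>n. s (r n) a"] by blast
  have "strict_mono (r \<circ> q)" using r(1) q(1) by (simp add: strict_mono_o)
  moreover have "mono (\<lambda>n. s (r (q n)) i)" if "i \<in> A" for i
    using r(2) that strict_mono_mono[OF q(1)] by (auto simp: mono_def)
  ultimately show ?case using q(2) by (intro exI[of _ "r \<circ> q"]) (auto simp: o_def)
qed

text \<open>\<open>T\<close> is the set of minimal elements. If it were infinite, a sequence of
  distinct minimal elements would have a coordinatewise nondecreasing subsequence, hence two
  comparable members. Below every element of \<open>S\<close> there is a minimal one because the
  coordinate sum drops strictly on going down.\<close>

lemma dickson:
  fixes S :: "('a::finite \<Rightarrow> nat) set"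
  shows "\<exists>T\<subseteq>S. finite T \<and> (\<forall>s\<in>S. \<exists>t\<in>T. t \<le> s)"
proof -
  define T where "T = {t\<in>S. \<forall>s\<in>S. s \<le> t \<longrightarrow> s = t}"
  have "finite T"
  proof (rule ccontr)
    assume "infinite T"
    then obtain e :: "nat \<Rightarrow> 'a \<Rightarrow> nat" where e: "inj e" "range e \<subseteq> T"
      using infinite_countable_subset by blast
    obtain r :: "nat \<Rightarrow> nat" where r: "strict_mono r" "\<forall>i\<in>UNIV. mono (\<lambda>n. e (r n) i)"
      using ex_mono_subseq_fun[of UNIV e] by auto
    have "e (r 0) \<le> e (r 1)" using r(2) by (auto simp: mono_def le_fun_def)
    then have "e (r 0) = e (r 1)" using e(2) unfolding T_def by blast
    then have "r 0 = r 1" using e(1) by (simp add: inj_eq)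
    then show False using strict_monoD[OF r(1), of 0 1] by simp
  qed
  moreover have "\<exists>t\<in>T. t \<le> s" if "s \<in> S" for s
    using that
  proof (induction "\<Sum>i\<in>UNIV. s i" arbitrary: s rule: less_induct)
    case less
    show ?case
    proof (cases "s \<in> T")
      case False
      then obtain t where t: "t \<in> S" "t \<le> s" "t \<noteq> s" using less.prems unfolding T_def by blast
      from t obtain i where "t i < s i" by (metis ext le_fun_def order_le_neq_trans)
      then have "(\<Sum>i\<in>UNIV. t i) < (\<Sum>i\<in>UNIV. s i)"
        using t(2) by (intro sum_strict_mono_ex1) (auto simp: le_fun_def)
      from less.hyps[OF this t(1)] t(2) show ?thesis using order_trans by blast
    qed blast
  qed
  moreover have "T \<subseteq> S" by (auto simp: T_def)
  ultimately show ?thesis by (intro exI[of _ T]) simp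
qed

section \<open>Conformal and lexicographic order on integer vectors\<close>

text \<open>The relation behind Graver bases. It is used through its consequence that
  \<open>x - t\<close> lies between \<open>x\<close> and \<open>x - s\<close> in every
  coordinate.\<close>

definition conformal :: "int ^ 'd \<Rightarrow> int ^ 'd \<Rightarrow> bool" where
  "conformal t s \<longleftrightarrow> (\<forall>i. 0 \<le> t $ i \<and> t $ i \<le> s $ i \<or> s $ i \<le> t $ i \<and> t $ i \<le> 0)"

text \<open>\<open>enc\<close> records the positive and the negative part of every coordinate.
  Comparison of these codes forces the conformal relation, so Dickson's lemma supplies the
  basis.\<close>

lemma ex_finite_conformal_basis:
  fixes S :: "(int ^ 'd) set"
  shows "\<exists>T\<subseteq>S. finite T \<and> (\<forall>s\<in>S. \<exists>t\<in>T. conformal t s)"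
proof -
  define enc :: "int ^ 'd \<Rightarrow> 'd \<times> bool \<Rightarrow> nat"
    where "enc s = (\<lambda>(i, b). nat (if b then s $ i else - s $ i))" for s
  obtain T' where T': "T' \<subseteq> enc ` S" "finite T'" "\<And>s. s \<in> S \<Longrightarrow> \<exists>t\<in>T'. t \<le> enc s"
    using dickson[of "enc ` S"] by blast
  obtain T where T: "T \<subseteq> S" "finite T" "T' = enc ` T"
    using finite_subset_image[OF T'(2,1)] by blast
  have "conformal t s" if "enc t \<le> enc s" for t s
    unfolding conformal_def
  proof
    fix i
    show "0 \<le> t $ i \<and> t $ i \<le> s $ i \<or> s $ i \<le> t $ i \<and> t $ i \<le> 0"
      using le_funD[OF that, of "(i, True)"] le_funD[OF that, of "(i, False)"]
      by (auto simp: enc_def)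
  qed
  then have "\<forall>s\<in>S. \<exists>t\<in>T. conformal t s"
    using T'(3) unfolding T(3) by (metis imageE)
  then show ?thesis using T(1,2) by (intro exI[of _ T]) simp
qed

text \<open>Positivity for a lexicographic order; \<open>to_nat\<close> orders the coordinates,
  since the index type is merely finite.\<close>

definition lexpos :: "int ^ 'd \<Rightarrow> bool" where
  "lexpos k \<longleftrightarrow> (\<exists>i. 0 < k $ i \<and> (\<forall>j. to_nat j < to_nat i \<longrightarrow> k $ j = 0))"

lemma not_lexpos_0 [simp]: "\<not> lexpos 0"
  by (simp add: lexpos_def)

lemma lexpos_total:
  assumes "k \<noteq> 0"
  shows "lexpos k \<or> lexpos (- k)"
proof -
  obtain i where "k $ i \<noteq> 0" using assms by (auto simp: vec_eq_iff)
  then obtain i where i: "k $ i \<noteq> 0" "\<And>j. k $ j \<noteq> 0 \<Longrightarrow> to_nat i \<le> to_nat j"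
    using ex_has_least_nat[of "\<lambda>i. k $ i \<noteq> 0" i to_nat] by blast
  then have "\<forall>j. to_nat j < to_nat i \<longrightarrow> k $ j = 0" by (meson not_le)
  moreover from i(1) have "0 < k $ i \<or> 0 < (- k) $ i" by auto
  ultimately show ?thesis unfolding lexpos_def by (metis neg_equal_0_iff_equal vector_uminus_component)
qed

lemma lexpos_add:
  assumes "lexpos a" "lexpos b"
  shows "lexpos (a + b)"
proof -
  obtain i j where i: "0 < a $ i" "\<forall>l. to_nat l < to_nat i \<longrightarrow> a $ l = 0"
    and j: "0 < b $ j" "\<forall>l. to_nat l < to_nat j \<longrightarrow> b $ l = 0"
    using assms by (auto simp: lexpos_def)
  consider "to_nat i < to_nat j" | "to_nat j < to_nat i" | "i = j"
    by (metis linorder_cases to_nat_split)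
  then show ?thesis
  proof cases
    case 1
    then show ?thesis using i j unfolding lexpos_def by (intro exI[of _ i]) auto
  next
    case 2
    then show ?thesis using i j unfolding lexpos_def by (intro exI[of _ j]) auto
  next
    case 3
    then show ?thesis using i j unfolding lexpos_def by (intro exI[of _ i]) auto
  qed
qed

section \<open>Polynomial count of the classes in a box\<close>

definition grid :: "nat \<Rightarrow> (int ^ 'd) set" where
  "grid n = {0..(\<chi> i. int n - 1)}"

lemma mem_grid: "x \<in> grid n \<longleftrightarrow> (\<forall>i. 0 \<le> x $ i \<and> x $ i < int n)"
  by (auto simp: grid_def less_eq_vec_def)

lemma card_vec_components:
  fixes A :: "'d::finite \<Rightarrow> 'a set"
  assumes "\<And>i. finite (A i)"
  shows "finite {x :: 'a ^ 'd. \<forall>i. x $ i \<in> A i}" (is "finite ?X")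
    and "card {x :: 'a ^ 'd. \<forall>i. x $ i \<in> A i} = (\<Prod>i\<in>UNIV. card (A i))"
proof -
  have bij: "bij_betw vec_lambda (Pi\<^sub>E UNIV A) ?X"
    by (rule bij_betw_byWitness[where f' = vec_nth]) (auto simp: vec_lambda_inverse)
  have "finite (Pi\<^sub>E UNIV A)" using assms by (intro finite_PiE) auto
  then show "finite ?X" using bij bij_betw_finite by blast
  show "card ?X = (\<Prod>i\<in>UNIV. card (A i))"
    using bij_betw_same_card[OF bij] by (simp add: card_PiE)
qed

lemma finite_grid [simp]: "finite (grid n :: (int ^ 'd) set)"
proof -
  have "grid n = {x :: int ^ 'd. \<forall>i. x $ i \<in> {0..<int n}}"
    by (auto simp: mem_grid)
  then show ?thesis using card_vec_components(1)[of "\<lambda>_. {0..<int n}"] by simp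
qed

text \<open>
  Every class is represented by its lexicographically least element in the box. Minimality is tested
  by a finite set of lattice vectors (Dickson), so it depends only on the position of each coordinate
  relative to the two ends of \<open>{0..<n}\<close>.
\<close>

lemma card_image_grid_polynomial:
  fixes cl :: "int ^ 'd \<Rightarrow> 'b"
  assumes cong: "\<And>x y z. cl x = cl y \<Longrightarrow> cl (x + z) = cl (y + z)"
  shows "\<exists>C N. \<forall>n\<ge>2 * C. card (cl ` grid n) = (\<Sum>j\<le>CARD('d). N j * (n - 2 * C) ^ j)"
proof -
  define S where "S = {k. lexpos k \<and> cl k = cl 0}"
  obtain T where T: "T \<subseteq> S" "finite T"
    and conf: "\<And>s. s \<in> S \<Longrightarrow> \<exists>t\<in>T. conformal t s"
    using ex_finite_conformal_basis[of S] by blast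
  \<comment> \<open>\<open>U n\<close> turns out to be the set of lexicographically least
    representatives: no vector of the basis can be subtracted without leaving the box.\<close>
  define U where "U n = {x\<in>grid n. \<forall>t\<in>T. x - t \<notin> grid n}" for n
  have bij: "bij_betw cl (U n) (cl ` grid n)" for n
    unfolding bij_betw_def
  proof
    have *: False if "x \<in> U n" "y \<in> U n" "cl x = cl y" "lexpos (x - y)" for x y
    proof -
      have "cl (x - y) = cl 0" using cong[OF that(3), of "- y"] by simp
      then have "x - y \<in> S" using that(4) by (simp add: S_def)
      then obtain t where t: "t \<in> T" "conformal t (x - y)" using conf by blast
      \<comment> \<open>By conformality every coordinate of \<open>x - t\<close> lies between those
        of \<open>y\<close> and \<open>x\<close>, which are both in the box.\<close>
      have "x - t \<in> grid n"
        unfolding mem_grid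
      proof
        fix i
        have "0 \<le> x $ i" "x $ i < int n" "0 \<le> y $ i" "y $ i < int n"
          using that(1,2) by (auto simp: U_def mem_grid)
        then show "0 \<le> (x - t) $ i \<and> (x - t) $ i < int n" using t(2)[unfolded conformal_def, rule_format, of i] by auto
      qed
      then show False using that(1) t(1) by (auto simp: U_def)
    qed
    show "inj_on cl (U n)"
    proof (rule inj_onI, rule ccontr)
      fix x y assume xy: "x \<in> U n" "y \<in> U n" "cl x = cl y" "x \<noteq> y"
      then have "lexpos (x - y) \<or> lexpos (y - x)" using lexpos_total[of "x - y"] by auto
      then show False using *[OF xy(1-3)] *[OF xy(2,1) xy(3)[symmetric]] by blast
    qed
    show "cl ` U n = cl ` grid n"
    proof
      show "cl ` grid n \<subseteq> cl ` U n"
      proof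
        fix c assume "c \<in> cl ` grid n"
        then obtain x where x: "x \<in> grid n" "c = cl x" by blast
        define A where "A = {y\<in>grid n. cl y = cl x}"
        \<comment> \<open>The part \<open>A\<close> of the class inside the box is finite and
          nonempty, so it has a least element \<open>m\<close>; subtracting a vector of
          \<open>T\<close> within the box would produce a smaller one.\<close>
        have "\<exists>m\<in>A. \<forall>y\<in>A. y \<noteq> m \<longrightarrow> \<not> lexpos (m - y)"
        proof (rule Finite_Set.bex_min_element[where R = "\<lambda>a b. lexpos (b - a)"])
          show "finite A" by (simp add: A_def)
          show "A \<noteq> {}" using x by (auto simp: A_def)
          show "transp_on A (\<lambda>a b. lexpos (b - a))"
          proof (rule transp_onI)
            fix a b c assume "lexpos (b - a)" "lexpos (c - b)"
            then show "lexpos (c - a)" using lexpos_add[of "b - a" "c - b"] by simp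
          qed
          show "asymp_on A (\<lambda>a b. lexpos (b - a))"
          proof (rule asymp_onI, rule notI)
            fix a b assume "lexpos (b - a)" "lexpos (a - b)"
            then show False using lexpos_add[of "b - a" "a - b"] by simp
          qed
        qed
        then obtain m where m: "m \<in> A" "\<And>y. y \<in> A \<Longrightarrow> y \<noteq> m \<Longrightarrow> \<not> lexpos (m - y)" by blast
        have "m - t \<notin> grid n" if "t \<in> T" for t
        proof
          assume g: "m - t \<in> grid n"
          have t: "lexpos t" "cl t = cl 0" using that T(1) by (auto simp: S_def)
          have "cl m = cl (m - t)" using cong[OF t(2), of "m - t"] by simp
          then have "m - t \<in> A" using g m(1) by (simp add: A_def)
          moreover have "m - t \<noteq> m" using t(1) by auto
          ultimately show False using m(2)[of "m - t"] t(1) by simp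
        qed
        then have "m \<in> U n" using m(1) by (simp add: U_def A_def)
        moreover have "c = cl m" using m(1) x(2) by (simp add: A_def)
        ultimately show "c \<in> cl ` U n" by blast
      qed
    qed (auto simp: U_def)
  qed
  \<comment> \<open>\<open>C\<close> bounds all entries of \<open>T\<close>, so only coordinates
    within distance \<open>C\<close> of an end of \<open>{0..<n}\<close> can leave this interval
    when an entry is subtracted.\<close>
  obtain C :: nat where C: "\<And>t i. t \<in> T \<Longrightarrow> \<bar>t $ i\<bar> \<le> int C"
  proof -
    have fin: "finite ((\<lambda>(t, i). nat \<bar>t $ i\<bar>) ` (T \<times> UNIV))" using T(2) by simp
    have "nat \<bar>t $ i\<bar> \<le> Max ((\<lambda>(t, i). nat \<bar>t $ i\<bar>) ` (T \<times> UNIV))" if "t \<in> T" for t i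
      using that by (intro Max_ge[OF fin]) force
    then show ?thesis using that unfolding nat_le_iff by blast
  qed
  \<comment> \<open>The code of a coordinate: \<open>{0..<C}\<close> for the lower end,
    \<open>{C..<2 * C}\<close> for the upper end (shifted so that the position \<open>n\<close>
    would become \<open>2 * C\<close>), and the single value \<open>2 * C\<close> for everything
    between.\<close>
  define st :: "nat \<Rightarrow> int \<Rightarrow> int" where
    "st n z = (if z < int C then z else if int n - int C \<le> z then z - int n + 2 * int C else 2 * int C)" for n z
  \<comment> \<open>Leaving the interval, read off the code: below 0 at the lower end; at or above
    \<open>n\<close>, hence \<open>2 * C\<close> in the shifted scale, at the upper end. Interior
    coordinates never leave.\<close>
  define bad :: "int \<Rightarrow> int \<Rightarrow> bool" where
    "bad a k \<longleftrightarrow> a < int C \<and> a - k < 0 \<or> int C \<le> a \<and> a < 2 * int C \<and> 2 * int C \<le> a - k" for a k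
  define P where "P = {\<sigma> :: int ^ 'd. (\<forall>i. \<sigma> $ i \<in> {0..2 * int C}) \<and> (\<forall>t\<in>T. \<exists>i. bad (\<sigma> $ i) (t $ i))}"
  define V where "V n a = {z. 0 \<le> z \<and> z < int n \<and> st n z = a}" for n a
  \<comment> \<open>A coordinate with code \<open>2 * C\<close> has \<open>n - 2 * C\<close>
    possible values, any other code fixes it. A vector \<open>\<sigma>\<close> of codes thus stands
    for \<open>(n - 2 * C) ^ e \<sigma>\<close> points, and \<open>N j\<close> counts the admissible
    vectors with \<open>j\<close> free coordinates.\<close>
  define e where "e \<sigma> = card {i. \<sigma> $ i = 2 * int C}" for \<sigma> :: "int ^ 'd"
  define N where "N j = card {\<sigma>\<in>P. e \<sigma> = j}" for j
  have finP: "finite P"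
    using card_vec_components(1)[of "\<lambda>_::'d. {0..2 * int C}"]
    by (rule finite_subset[rotated]) (auto simp: P_def)
  have "card (cl ` grid n) = (\<Sum>j\<le>CARD('d). N j * (n - 2 * C) ^ j)" if n: "2 * C \<le> n" for n
  proof -
    \<comment> \<open>With \<open>2 * C \<le> n\<close> the two ends do not overlap, so the code
      decides membership exactly.\<close>
    have badI: "bad (st n z) k \<longleftrightarrow> \<not> (0 \<le> z - k \<and> z - k < int n)"
      if "0 \<le> z" "z < int n" "\<bar>k\<bar> \<le> int C" for z k
      using that n by (auto simp: st_def bad_def)
    have U_eq: "U n = (\<Union>\<sigma>\<in>P. {x. \<forall>i. x $ i \<in> V n (\<sigma> $ i)})"
    proof (intro Set.set_eqI iffI)
      fix x assume x: "x \<in> U n"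
      then have g: "\<And>i. 0 \<le> x $ i \<and> x $ i < int n" by (auto simp: U_def mem_grid)
      have "(\<chi> i. st n (x $ i)) \<in> P"
        unfolding P_def
      proof (intro CollectI conjI allI ballI)
        fix i show "(\<chi> i. st n (x $ i)) $ i \<in> {0..2 * int C}"
          using g[of i] n by (auto simp: st_def)
      next
        fix t assume t: "t \<in> T"
        then have "x - t \<notin> grid n" using x by (simp add: U_def)
        then obtain i where "\<not> (0 \<le> x $ i - t $ i \<and> x $ i - t $ i < int n)"
          by (auto simp: mem_grid)
        then have "bad (st n (x $ i)) (t $ i)" using badI g C t by blast
        then show "\<exists>i. bad ((\<chi> i. st n (x $ i)) $ i) (t $ i)" by auto
      qed
      moreover have "x \<in> {x'. \<forall>i. x' $ i \<in> V n ((\<chi> i. st n (x $ i)) $ i)}"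
        using g by (simp add: V_def)
      ultimately show "x \<in> (\<Union>\<sigma>\<in>P. {x. \<forall>i. x $ i \<in> V n (\<sigma> $ i)})" by blast
    next
      fix x assume "x \<in> (\<Union>\<sigma>\<in>P. {x. \<forall>i. x $ i \<in> V n (\<sigma> $ i)})"
      then obtain \<sigma> where \<sigma>: "\<sigma> \<in> P" "\<And>i. x $ i \<in> V n (\<sigma> $ i)" by blast
      then have g: "\<And>i. 0 \<le> x $ i \<and> x $ i < int n" and s: "\<And>i. st n (x $ i) = \<sigma> $ i"
        by (auto simp: V_def)
      have "x - t \<notin> grid n" if t: "t \<in> T" for t
      proof -
        obtain i where "bad (\<sigma> $ i) (t $ i)" using \<sigma>(1) t by (auto simp: P_def)
        then have "\<not> (0 \<le> x $ i - t $ i \<and> x $ i - t $ i < int n)"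
          using badI g C t s by metis
        then show ?thesis by (auto simp: mem_grid)
      qed
      then show "x \<in> U n" using g by (simp add: U_def mem_grid)
    qed
    have V: "V n a = (if a < int C then {a} else if a < 2 * int C then {a + int n - 2 * int C}
        else {int C..<int n - int C})" if "0 \<le> a" "a \<le> 2 * int C" for a
      using that n by (auto simp: V_def st_def)
    have cardV: "finite (V n a)" "card (V n a) = (if a = 2 * int C then n - 2 * C else 1)"
      if "0 \<le> a" "a \<le> 2 * int C" for a
      using that n by (auto simp: V nat_diff_distrib)
    define Y where "Y \<sigma> = {x :: int ^ 'd. \<forall>i. x $ i \<in> V n (\<sigma> $ i)}" for \<sigma> :: "int ^ 'd"
    have Y: "finite (Y \<sigma>)" "card (Y \<sigma>) = (n - 2 * C) ^ e \<sigma>" if "\<sigma> \<in> P" for \<sigma>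
    proof -
      have \<sigma>: "\<And>i. 0 \<le> \<sigma> $ i \<and> \<sigma> $ i \<le> 2 * int C" using that by (auto simp: P_def)
      have fin: "\<And>i. finite (V n (\<sigma> $ i))" using cardV(1) \<sigma> by blast
      show "finite (Y \<sigma>)" unfolding Y_def by (rule card_vec_components(1)[OF fin])
      have "card (Y \<sigma>) = (\<Prod>i\<in>UNIV. card (V n (\<sigma> $ i)))"
        unfolding Y_def by (rule card_vec_components(2)[OF fin])
      also have "\<dots> = (\<Prod>i\<in>UNIV. if \<sigma> $ i = 2 * int C then n - 2 * C else 1)"
        using cardV(2) \<sigma> by (intro prod.cong) auto
      also have "\<dots> = (n - 2 * C) ^ e \<sigma>"
        by (simp add: prod.If_cases e_def)
      finally show "card (Y \<sigma>) = (n - 2 * C) ^ e \<sigma>" .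
    qed
    have "card (cl ` grid n) = card (U n)" using bij_betw_same_card[OF bij] by simp
    also have "\<dots> = card (\<Union>\<sigma>\<in>P. Y \<sigma>)" unfolding U_eq Y_def ..
    also have "\<dots> = (\<Sum>\<sigma>\<in>P. card (Y \<sigma>))"
    proof (rule card_UN_disjoint[OF finP])
      show "\<forall>\<sigma>\<in>P. \<forall>\<tau>\<in>P. \<sigma> \<noteq> \<tau> \<longrightarrow> Y \<sigma> \<inter> Y \<tau> = {}"
        by (force simp: Y_def V_def vec_eq_iff)
    qed (use Y in blast)
    also have "\<dots> = (\<Sum>\<sigma>\<in>P. (n - 2 * C) ^ e \<sigma>)" using Y by simp
    also have "\<dots> = (\<Sum>j\<le>CARD('d). \<Sum>\<sigma>\<in>{\<sigma>\<in>P. e \<sigma> = j}. (n - 2 * C) ^ e \<sigma>)"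
    proof (rule sum.group[symmetric, OF finP])
      show "e ` P \<subseteq> {..CARD('d)}"
      proof
        fix j assume "j \<in> e ` P"
        then obtain \<sigma> where "j = e \<sigma>" by blast
        then show "j \<in> {..CARD('d)}"
          using card_mono[OF finite_class.finite_UNIV subset_UNIV] by (simp add: e_def)
      qed
    qed (rule finite_atMost)
    also have "\<dots> = (\<Sum>j\<le>CARD('d). N j * (n - 2 * C) ^ j)"
      by (simp add: N_def)
    finally show ?thesis .
  qed
  then show ?thesis by blast
qed

text \<open>The upper bound kills all coefficients of degree above \<open>p\<close>, so the quotient
  tends to the coefficient of degree \<open>p\<close>. The lower bound along multiples of
  \<open>q\<close> keeps the limit at least \<open>1 / q ^ p\<close>, hence positive.\<close>

lemma polynomial_growth_limit:
  fixes a :: "nat \<Rightarrow> nat" and A :: real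
  assumes poly: "\<And>n. 2 * C \<le> n \<Longrightarrow> a n = (\<Sum>j\<le>d. N j * (n - 2 * C) ^ j)"
    and upper: "\<And>n. 1 \<le> n \<Longrightarrow> real (a n) \<le> A * real n ^ p"
    and lower: "\<And>m. 1 \<le> m \<Longrightarrow> m ^ p \<le> a (q * m)" and q: "1 \<le> q"
  shows "\<exists>L>0. (\<lambda>n. real (a n) / real n ^ p) \<longlonglongrightarrow> L"
proof -
  have zero: "N j = 0" if j: "p < j" "j \<le> d" for j
  proof (rule ccontr)
    assume "N j \<noteq> 0"
    \<comment> \<open>\<open>n\<close> is at least \<open>4 * C\<close>, so that it is at most twice
      \<open>n - 2 * C\<close>, and it exceeds \<open>2 ^ (p + 1) * A\<close>, the largest value
      that the two estimates below permit.\<close>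
    define n where "n = 4 * C + 2 + nat \<lceil>\<bar>A\<bar>\<rceil> * 2 ^ (p + 1)"
    have n: "2 * C \<le> n" "1 \<le> n" "1 \<le> n - 2 * C" "n \<le> 2 * (n - 2 * C)" by (auto simp: n_def)
    have "(n - 2 * C) ^ (p + 1) \<le> (n - 2 * C) ^ j" using n j by (intro power_increasing) auto
    also have "\<dots> \<le> N j * (n - 2 * C) ^ j" using \<open>N j \<noteq> 0\<close> by simp
    also have "\<dots> \<le> a n" unfolding poly[OF n(1)] using j by (intro member_le_sum) auto
    finally have "real ((n - 2 * C) ^ (p + 1)) \<le> real (a n)" by (simp only: of_nat_le_iff)
    also have "\<dots> \<le> A * real n ^ p" using upper n by simp
    finally have 1: "real ((n - 2 * C) ^ (p + 1)) \<le> A * real n ^ p" .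
    have "n ^ (p + 1) \<le> (2 * (n - 2 * C)) ^ (p + 1)" using n(4) by (rule power_mono) simp
    then have "real (n ^ (p + 1)) \<le> real ((2 * (n - 2 * C)) ^ (p + 1))" by (simp only: of_nat_le_iff)
    also have "\<dots> = 2 ^ (p + 1) * real ((n - 2 * C) ^ (p + 1))"
      by (simp only: power_mult_distrib of_nat_mult) simp
    also have "\<dots> \<le> 2 ^ (p + 1) * (A * real n ^ p)" using 1 by (intro mult_left_mono) auto
    finally have "real n * real n ^ p \<le> (2 ^ (p + 1) * A) * real n ^ p" by (simp add: mult_ac)
    then have "real n \<le> 2 ^ (p + 1) * A" using n(2) by (simp add: mult_le_cancel_right)
    also have "\<dots> \<le> 2 ^ (p + 1) * real (nat \<lceil>\<bar>A\<bar>\<rceil>)"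
      by (intro mult_left_mono) (auto, linarith)
    also have "\<dots> < real n" by (simp add: n_def)
    finally show False by simp
  qed
  have lim: "(\<lambda>n. real (N j * (n - 2 * C) ^ j) / real n ^ p) \<longlonglongrightarrow> (if j = p then real (N j) else 0)"
    if "j \<le> d" for j
  proof -
    consider "p < j" | "j = p" | "j < p" by linarith
    then show ?thesis
    proof cases
      case 1
      then show ?thesis using zero that by simp
    next
      case 2
      have "(\<lambda>n. real (n - 2 * C) / real n) \<longlonglongrightarrow> 1"
      proof (rule Lim_transform_eventually)
        show "(\<lambda>n. 1 - real (2 * C) / real n) \<longlonglongrightarrow> 1"
          by (rule tendsto_eq_intros lim_const_over_n refl)+ simp
        show "\<forall>\<^sub>F n in sequentially. 1 - real (2 * C) / real n = real (n - 2 * C) / real n"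
          using eventually_ge_at_top[of "2 * C + 1"]
          by eventually_elim (simp add: of_nat_diff field_simps)
      qed
      then have "(\<lambda>n. real (N p) * (real (n - 2 * C) / real n) ^ p) \<longlonglongrightarrow> real (N p) * 1 ^ p"
        by (intro tendsto_intros)
      then show ?thesis using 2 by (simp add: power_divide)
    next
      case 3
      have "(\<lambda>n. real (N j * (n - 2 * C) ^ j) / real n ^ p) \<longlonglongrightarrow> 0"
      proof (rule tendsto_sandwich[where f = "\<lambda>_. 0"])
        show "\<forall>\<^sub>F n in sequentially. real (N j * (n - 2 * C) ^ j) / real n ^ p \<le> real (N j) / real n"
          using eventually_ge_at_top[of 1]
        proof eventually_elim
          case (elim n)
          have "real (n - 2 * C) ^ j * real n \<le> real n ^ j * real n"
            by (intro mult_right_mono power_mono) auto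
          also have "\<dots> = real n ^ (j + 1)" by simp
          also have "\<dots> \<le> real n ^ p" using elim 3 by (intro power_increasing) auto
          finally have "real (N j) * (real (n - 2 * C) ^ j * real n) \<le> real (N j) * real n ^ p"
            by (intro mult_left_mono) auto
          then show ?case using elim by (simp add: field_simps)
        qed
        show "(\<lambda>n. real (N j) / real n) \<longlonglongrightarrow> 0" by (rule lim_const_over_n)
      qed (auto simp: tendsto_const)
      then show ?thesis using 3 by simp
    qed
  qed
  \<comment> \<open>This is \<open>N p\<close> when \<open>p \<le> d\<close> and 0 otherwise; the
    lower bound rules the value 0 out.\<close>
  define L where "L = (\<Sum>j\<le>d. if j = p then real (N j) else 0)"
  have L: "(\<lambda>n. real (a n) / real n ^ p) \<longlonglongrightarrow> L"
  proof (rule Lim_transform_eventually)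
    show "(\<lambda>n. \<Sum>j\<le>d. real (N j * (n - 2 * C) ^ j) / real n ^ p) \<longlonglongrightarrow> L"
      unfolding L_def using lim by (intro tendsto_sum) auto
    show "\<forall>\<^sub>F n in sequentially. (\<Sum>j\<le>d. real (N j * (n - 2 * C) ^ j) / real n ^ p) = real (a n) / real n ^ p"
      using eventually_ge_at_top[of "2 * C"]
      by eventually_elim (simp add: poly sum_divide_distrib)
  qed
  have "strict_mono (\<lambda>m. q * m)" using q by (simp add: strict_mono_def)
  from LIMSEQ_subseq_LIMSEQ[OF L this]
  have "(\<lambda>m. real (a (q * m)) / real (q * m) ^ p) \<longlonglongrightarrow> L" by (simp add: o_def)
  moreover have "\<forall>\<^sub>F m in sequentially. 1 / real q ^ p \<le> real (a (q * m)) / real (q * m) ^ p"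
    using eventually_ge_at_top[of 1]
  proof eventually_elim
    case (elim m)
    have "real m ^ p \<le> real (a (q * m))"
      using lower[OF elim] by (metis of_nat_le_iff of_nat_power)
    then show ?case using elim q by (simp add: field_simps)
  qed
  ultimately have "1 / real q ^ p \<le> L"
    by (intro tendsto_lowerbound[where F = sequentially]) auto
  moreover have "0 < 1 / real q ^ p" using q by simp
  ultimately have "0 < L" by linarith
  then show ?thesis using L by blast
qed

section \<open>Quotients of the integer lattice of rank p\<close>

definition add_subgroup :: "'g::ab_group_add set \<Rightarrow> bool" where
  "add_subgroup H \<longleftrightarrow> 0 \<in> H \<and> (\<forall>x\<in>H. \<forall>y\<in>H. x - y \<in> H)"

lemma add_subgroup_closed:
  assumes "add_subgroup H"
  shows add_subgroup_zero: "0 \<in> H"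
    and add_subgroup_diff: "\<And>x y. x \<in> H \<Longrightarrow> y \<in> H \<Longrightarrow> x - y \<in> H"
    and add_subgroup_uminus: "\<And>x. x \<in> H \<Longrightarrow> - x \<in> H"
    and add_subgroup_add: "\<And>x y. x \<in> H \<Longrightarrow> y \<in> H \<Longrightarrow> x + y \<in> H"
proof -
  show 0: "0 \<in> H" and diff: "\<And>x y. x \<in> H \<Longrightarrow> y \<in> H \<Longrightarrow> x - y \<in> H"
    using assms by (auto simp: add_subgroup_def)
  show neg: "\<And>x. x \<in> H \<Longrightarrow> - x \<in> H"
    using diff[OF 0] by simp
  show "\<And>x y. x \<in> H \<Longrightarrow> y \<in> H \<Longrightarrow> x + y \<in> H"
    using diff[OF _ neg] by simp
qed

lemma add_subgroup_sum:
  assumes "add_subgroup H" "\<And>i. i \<in> I \<Longrightarrow> x i \<in> H"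
  shows "(\<Sum>i\<in>I. x i) \<in> H"
  using assms(2)
  by (induction I rule: infinite_finite_induct) (auto intro: add_subgroup_closed[OF assms(1)])

text \<open>Induction on \<open>k\<close> from 0 in both directions. \<open>scale\<close> is
  abstract because it is instantiated with \<open>frag_cmul\<close>, the multiples in a free abelian
  group, and additivity is asked on \<open>H\<close> only because \<open>\<eta>\<close> need not be
  additive elsewhere.\<close>

lemma additive_on_scale:
  fixes \<eta> :: "'b::ab_group_add \<Rightarrow> int ^ 'd" and scale :: "int \<Rightarrow> 'b \<Rightarrow> 'b"
  assumes add: "\<And>x y. x \<in> H \<Longrightarrow> y \<in> H \<Longrightarrow> \<eta> (x + y) = \<eta> x + \<eta> y"
    and scale: "\<And>k x. x \<in> H \<Longrightarrow> scale k x \<in> H" "\<And>x. scale 0 x = 0"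
      "\<And>k x. scale (k + 1) x = scale k x + x"
    and "x \<in> H"
  shows "\<eta> (scale k x) = k *s \<eta> x"
proof -
  have step: "\<eta> (scale (k + 1) x) = \<eta> (scale k x) + \<eta> x" for k
    using add[OF scale(1)[OF \<open>x \<in> H\<close>] \<open>x \<in> H\<close>] by (simp add: scale(3))
  have zero: "\<eta> (scale 0 x) = 0"
    using add[OF scale(1) scale(1), OF \<open>x \<in> H\<close> \<open>x \<in> H\<close>, of 0 0] by (simp add: scale(2))
  show ?thesis
  proof (induction k rule: int_induct[of _ 0])
    case base
    show ?case using zero by simp
  next
    case (step1 k)
    show ?case using step1(2) step[of k] by (simp add: vector_sadd_rdistrib)
  next
    case (step2 k)
    have "(k - 1) *s \<eta> x = k *s \<eta> x - \<eta> x" by (simp add: vec_eq_iff algebra_simps)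
    then show ?case using step2(2) step[of "k - 1"] by simp
  qed
qed

lemma add_subgroup_smult:
  fixes H :: "(int ^ 'd) set"
  assumes "add_subgroup H" "x \<in> H"
  shows "k *s x \<in> H"
proof (induction k rule: int_induct[of _ 0])
  case base
  show ?case by (simp add: add_subgroup_zero[OF assms(1)])
next
  case (step1 k)
  show ?case using add_subgroup_add[OF assms(1) step1(2) assms(2)] by (simp add: vector_sadd_rdistrib)
next
  case (step2 k)
  have "(k - 1) *s x = k *s x - x" by (simp add: vec_eq_iff algebra_simps)
  then show ?case using add_subgroup_diff[OF assms(1) step2(2) assms(2)] by simp
qed

definition lin_comb :: "nat \<Rightarrow> (nat \<Rightarrow> int ^ 'd) \<Rightarrow> (nat \<Rightarrow> int) \<Rightarrow> int ^ 'd" where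
  "lin_comb p a m = (\<Sum>j<p. m j *s a j)"

lemma lin_comb_component: "lin_comb p a m $ i = (\<Sum>j<p. m j * a j $ i)"
  by (simp add: lin_comb_def)

lemma vec_int_expansion: "t = (\<Sum>i\<in>UNIV. (t $ i) *s (axis i 1 :: int ^ 'd))"
  by (simp add: vec_eq_iff axis_def if_distrib cong: if_cong)

section \<open>Growth of the image of a box in the quotient\<close>

text \<open>The fibres of \<open>cl\<close> are the cosets of the kernel \<open>K\<close>, the
  vectors \<open>a j\<close> lift a basis of the free part of the quotient, and \<open>V\<close> is
  the preimage of the finite part.\<close>

locale lattice_quotient =
  fixes cl :: "int ^ 'd \<Rightarrow> 'b" and K :: "(int ^ 'd) set"
    and V :: "(int ^ 'd) set" and a :: "nat \<Rightarrow> int ^ 'd" and p :: nat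
  assumes cl_eq_iff: "cl x = cl y \<longleftrightarrow> x - y \<in> K"
    and K: "add_subgroup K" and V: "add_subgroup V" and finite_clV: "finite (cl ` V)"
    and decompose: "\<And>t. \<exists>m. \<exists>v\<in>V. t - lin_comb p a m - v \<in> K"
    and independent: "\<And>m j. lin_comb p a m \<in> K \<Longrightarrow> j < p \<Longrightarrow> m j = 0"
begin

lemma cl_add_cong: "cl x = cl y \<Longrightarrow> cl (x + z) = cl (y + z)"
  by (simp add: cl_eq_iff)

lemma add_subgroup_range_lin_comb: "add_subgroup (range (lin_comb p a))"
proof -
  have "lin_comb p a m - lin_comb p a m' \<in> range (lin_comb p a)" for m m'
  proof
    show "lin_comb p a m - lin_comb p a m' = lin_comb p a (\<lambda>j. m j - m' j)"
      by (simp add: vec_eq_iff lin_comb_component algebra_simps sum_subtractf)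
  qed simp
  moreover have "0 \<in> range (lin_comb p a)"
    by (rule image_eqI[of _ _ "\<lambda>_. 0"]) (simp_all add: lin_comb_def)
  ultimately show ?thesis unfolding add_subgroup_def by blast
qed

lemma inj_on_range_lin_comb: "inj_on cl (range (lin_comb p a))"
proof (rule inj_onI)
  fix x y assume "x \<in> range (lin_comb p a)" "y \<in> range (lin_comb p a)" and eq: "cl x = cl y"
  then obtain m m' where m: "x = lin_comb p a m" "y = lin_comb p a m'" by blast
  have "lin_comb p a m - lin_comb p a m' = lin_comb p a (\<lambda>j. m j - m' j)"
    by (simp add: vec_eq_iff lin_comb_component algebra_simps sum_subtractf)
  then have "lin_comb p a (\<lambda>j. m j - m' j) \<in> K" using eq by (simp add: cl_eq_iff m)
  then have "m j = m' j" if "j < p" for j using independent[of "\<lambda>j. m j - m' j", OF _ that] by simp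
  then show "x = y" by (simp add: m lin_comb_def)
qed

text \<open>Up to the kernel the lattice consists of finitely many translates of
  \<open>range (lin_comb p a)\<close>. In the dissipative case this carries finiteness from orbits
  of \<open>F\<close> to full orbits.\<close>

lemma ex_finite_torsion_reps: "\<exists>N\<subseteq>V. finite N \<and> (\<forall>t. \<exists>m. \<exists>v\<in>N. cl t = cl (lin_comb p a m + v))"
proof -
  obtain N where N: "N \<subseteq> V" "finite N" "cl ` V = cl ` N"
    using finite_subset_image[OF finite_clV subset_refl] by blast
  have "\<exists>m. \<exists>v\<in>N. cl t = cl (lin_comb p a m + v)" for t
  proof -
    obtain m v where mv: "v \<in> V" "t - lin_comb p a m - v \<in> K" using decompose by blast
    obtain v' where v': "v' \<in> N" "cl v = cl v'" using mv(1) N(3) by blast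
    have "cl t = cl (v + lin_comb p a m)"
      using mv(2) by (simp add: cl_eq_iff algebra_simps)
    also have "\<dots> = cl (v' + lin_comb p a m)" by (rule cl_add_cong[OF v'(2)])
    finally show ?thesis using v'(1) by (auto simp: add.commute)
  qed
  then show ?thesis using N by blast
qed

text \<open>Writing \<open>t\<close> through the unit vectors bounds its coefficients on the
  \<open>a j\<close> linearly in \<open>n\<close>, and the remaining part meets finitely many
  classes only. So there are at most \<open>(2 * n * B + 1) ^ p * card N\<close> classes.\<close>

lemma card_image_grid_upper: "\<exists>A::real. \<forall>n\<ge>1. real (card (cl ` grid n)) \<le> A * real n ^ p"
proof -
  have "\<forall>i. \<exists>m v. v \<in> V \<and> axis i 1 - lin_comb p a m - v \<in> K" using decompose by blast
  then obtain \<mu> \<nu> where ax: "\<And>i. \<nu> i \<in> V" "\<And>i. axis i 1 - lin_comb p a (\<mu> i) - \<nu> i \<in> K" by metis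
  obtain N where N: "N \<subseteq> V" "finite N" "cl ` V = cl ` N"
    using finite_subset_image[OF finite_clV subset_refl] by blast
  define B where "B = (\<Sum>j<p. \<Sum>i\<in>UNIV. \<bar>\<mu> i j\<bar>)"
  have B: "(\<Sum>i\<in>UNIV. \<bar>\<mu> i j\<bar>) \<le> B" if "j < p" for j
    unfolding B_def using that by (intro member_le_sum) (auto intro: sum_nonneg)
  have B0: "0 \<le> B" unfolding B_def by (auto intro: sum_nonneg)
  define E where "E n = (\<Pi>\<^sub>E j\<in>{..<p}. {- (int n * B)..int n * B})" for n :: nat
  have sub: "cl ` grid n \<subseteq> (\<lambda>(m, v). cl (lin_comb p a m + v)) ` (E n \<times> N)" for n
  proof
    fix c assume "c \<in> cl ` grid n"
    then obtain t where t: "t \<in> grid n" "c = cl t" by blast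
    define m where "m j = (\<Sum>i\<in>UNIV. t $ i * \<mu> i j)" for j
    define v where "v = (\<Sum>i\<in>UNIV. t $ i *s \<nu> i)"
    have "v \<in> V" unfolding v_def by (intro add_subgroup_sum[OF V] add_subgroup_smult[OF V] ax)
    then obtain v' where v': "v' \<in> N" "cl v = cl v'" using N by blast
    have "(\<Sum>i\<in>UNIV. t $ i *s (axis i 1 - lin_comb p a (\<mu> i) - \<nu> i)) \<in> K"
      by (intro add_subgroup_sum[OF K] add_subgroup_smult[OF K] ax)
    also have "(\<Sum>i\<in>UNIV. t $ i *s (axis i 1 - lin_comb p a (\<mu> i) - \<nu> i)) = t - lin_comb p a m - v"
    proof -
      have "lin_comb p a m = (\<Sum>i\<in>UNIV. t $ i *s lin_comb p a (\<mu> i))"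
      proof (intro iffD2[OF vec_eq_iff] allI)
        fix k
        have "lin_comb p a m $ k = (\<Sum>j<p. \<Sum>i\<in>UNIV. t $ i * (\<mu> i j * a j $ k))"
          by (simp add: lin_comb_component m_def sum_distrib_right mult.assoc)
        also have "\<dots> = (\<Sum>i\<in>UNIV. \<Sum>j<p. t $ i * (\<mu> i j * a j $ k))"
          by (rule sum.swap)
        also have "\<dots> = (\<Sum>i\<in>UNIV. t $ i *s lin_comb p a (\<mu> i)) $ k"
          by (simp add: lin_comb_component sum_distrib_left)
        finally show "lin_comb p a m $ k = (\<Sum>i\<in>UNIV. t $ i *s lin_comb p a (\<mu> i)) $ k" .
      qed
      then show ?thesis
        by (simp add: v_def vector_ssub_ldistrib sum_subtractf vec_int_expansion[of t, symmetric])
    qed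
    finally have "cl t = cl (v + lin_comb p a m)" by (simp add: cl_eq_iff algebra_simps)
    also have "\<dots> = cl (v' + lin_comb p a m)" by (rule cl_add_cong[OF v'(2)])
    \<comment> \<open>\<open>E n\<close> contains only functions that are undefined outside
      \<open>{..<p}\<close>, and \<open>lin_comb p a\<close> ignores those arguments.\<close>
    also have "lin_comb p a m = lin_comb p a (restrict m {..<p})" by (simp add: lin_comb_def)
    finally have "c = cl (lin_comb p a (restrict m {..<p}) + v')" using t(2) by (simp add: add.commute)
    moreover have "restrict m {..<p} \<in> E n"
    proof -
      have "\<bar>m j\<bar> \<le> int n * B" if "j < p" for j
      proof -
        have "\<bar>m j\<bar> \<le> (\<Sum>i\<in>UNIV. \<bar>t $ i * \<mu> i j\<bar>)" unfolding m_def by (rule sum_abs)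
        also have "\<dots> \<le> (\<Sum>i\<in>UNIV. int n * \<bar>\<mu> i j\<bar>)"
          using t(1) by (intro sum_mono) (auto simp: mem_grid abs_mult less_imp_le intro!: mult_right_mono)
        also have "\<dots> = int n * (\<Sum>i\<in>UNIV. \<bar>\<mu> i j\<bar>)" by (simp add: sum_distrib_left)
        also have "\<dots> \<le> int n * B" using B[OF that] by (intro mult_left_mono) auto
        finally show ?thesis .
      qed
      then show ?thesis by (auto simp: E_def abs_le_iff minus_le_iff)
    qed
    ultimately show "c \<in> (\<lambda>(m, v). cl (lin_comb p a m + v)) ` (E n \<times> N)" using v'(1) by force
  qed
  have "real (card (cl ` grid n)) \<le> (real_of_int (2 * B + 1) ^ p * real (card N)) * real n ^ p" if "1 \<le> n" for n
  proof -
    have fin: "finite (E n)" unfolding E_def by (intro finite_PiE) auto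
    have "card (cl ` grid n) \<le> card ((\<lambda>(m, v). cl (lin_comb p a m + v)) ` (E n \<times> N))"
      using fin N(2) by (intro card_mono[OF _ sub]) auto
    also have "\<dots> \<le> card (E n \<times> N)" using fin N(2) by (intro card_image_le) auto
    also have "\<dots> = nat (2 * int n * B + 1) ^ p * card N"
      by (simp add: E_def card_cartesian_product card_PiE algebra_simps)
    finally have "real (card (cl ` grid n)) \<le> real (nat (2 * int n * B + 1) ^ p * card N)"
      by (simp only: of_nat_le_iff)
    also have "\<dots> = real_of_int (2 * int n * B + 1) ^ p * real (card N)" using B0 by simp
    also have "\<dots> \<le> (real_of_int ((2 * B + 1) * int n)) ^ p * real (card N)"
    proof (intro mult_right_mono power_mono)
      show "real_of_int (2 * int n * B + 1) \<le> real_of_int ((2 * B + 1) * int n)"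
        using that by (simp only: of_int_le_iff) (simp add: algebra_simps)
    qed (use B0 in auto)
    finally show ?thesis by (simp add: power_mult_distrib mult_ac)
  qed
  then show ?thesis by blast
qed

text \<open>Independence makes the \<open>m ^ p\<close> combinations with coefficients in
  \<open>{0..<m}\<close> pairwise inequivalent. Their coordinates are at most \<open>m * B\<close>
  in modulus, so the shift by \<open>z\<close> moves them into the range from 0 to
  \<open>2 * m * B\<close>, which is below \<open>q * m\<close> for
  \<open>q = 2 * B + 1\<close>.\<close>

lemma card_image_grid_lower: "\<exists>q\<ge>1. \<forall>m\<ge>1. m ^ p \<le> card (cl ` grid (q * m))"
proof -
  define B where "B = (\<Sum>i\<in>UNIV. \<Sum>j<p. \<bar>a j $ i\<bar>)"
  have B: "(\<Sum>j<p. \<bar>a j $ i\<bar>) \<le> B" for i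
    unfolding B_def by (rule member_le_sum) (auto intro: sum_nonneg)
  have B0: "0 \<le> B" unfolding B_def by (auto intro: sum_nonneg)
  define q where "q = nat (2 * B + 1)"
  have "m ^ p \<le> card (cl ` grid (q * m))" if "1 \<le> m" for m
  proof -
    define E where "E = (\<Pi>\<^sub>E j\<in>{..<p}. {0..<int m})"
    define z :: "int ^ 'd" where "z = (\<chi> i. int m * B)"
    have inj: "inj_on (\<lambda>k. cl (lin_comb p a k + z)) E"
    proof (rule inj_onI)
      fix k l assume kl: "k \<in> E" "l \<in> E" "cl (lin_comb p a k + z) = cl (lin_comb p a l + z)"
      have "lin_comb p a (\<lambda>j. k j - l j) = lin_comb p a k - lin_comb p a l"
        by (simp add: vec_eq_iff lin_comb_component algebra_simps sum_subtractf)
      then have "lin_comb p a (\<lambda>j. k j - l j) \<in> K" using kl(3) by (simp add: cl_eq_iff)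
      then have "k j = l j" if "j < p" for j using independent[of "\<lambda>j. k j - l j", OF _ that] by simp
      then show "k = l" using kl(1,2) unfolding E_def by (auto intro: PiE_ext)
    qed
    have sub: "(\<lambda>k. cl (lin_comb p a k + z)) ` E \<subseteq> cl ` grid (q * m)"
    proof clarify
      fix k assume k: "k \<in> E"
      have "\<bar>lin_comb p a k $ i\<bar> \<le> int m * B" for i
      proof -
        have "\<bar>lin_comb p a k $ i\<bar> \<le> (\<Sum>j<p. \<bar>k j * a j $ i\<bar>)"
          unfolding lin_comb_component by (rule sum_abs)
        also have "\<dots> \<le> (\<Sum>j<p. int m * \<bar>a j $ i\<bar>)"
        proof (intro sum_mono)
          fix j assume "j \<in> {..<p}"
          then have "0 \<le> k j" "k j \<le> int m" using PiE_mem[OF k[unfolded E_def]] by (auto simp: less_imp_le)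
          then show "\<bar>k j * a j $ i\<bar> \<le> int m * \<bar>a j $ i\<bar>" by (auto simp: abs_mult intro!: mult_right_mono)
        qed
        also have "\<dots> = int m * (\<Sum>j<p. \<bar>a j $ i\<bar>)" by (simp add: sum_distrib_left)
        also have "\<dots> \<le> int m * B" using B by (intro mult_left_mono) auto
        finally show ?thesis .
      qed
      moreover have "int (q * m) = 2 * (int m * B) + int m" using B0 by (simp add: q_def algebra_simps)
      moreover have "(lin_comb p a k + z) $ i = lin_comb p a k $ i + int m * B" for i by (simp add: z_def)
      moreover have "1 \<le> int m" using that by simp
      ultimately have "0 \<le> (lin_comb p a k + z) $ i \<and> (lin_comb p a k + z) $ i < int (q * m)" for i
        by (smt (verit))
      then have "lin_comb p a k + z \<in> grid (q * m)" by (simp only: mem_grid) simp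
      then show "cl (lin_comb p a k + z) \<in> cl ` grid (q * m)" by blast
    qed
    have "m ^ p = card E" by (simp add: E_def card_PiE)
    also have "\<dots> = card ((\<lambda>k. cl (lin_comb p a k + z)) ` E)" by (rule card_image[OF inj, symmetric])
    also have "\<dots> \<le> card (cl ` grid (q * m))" by (intro card_mono sub) simp
    finally show ?thesis .
  qed
  moreover have "1 \<le> q" using B0 by (simp add: q_def)
  ultimately show ?thesis by blast
qed

lemma card_image_grid_asymp: "\<exists>L>0. (\<lambda>n. real (card (cl ` grid n)) / real n ^ p) \<longlonglongrightarrow> L"
proof -
  obtain C N where poly: "\<And>n. 2 * C \<le> n \<Longrightarrow> card (cl ` grid n) = (\<Sum>j\<le>CARD('d). N j * (n - 2 * C) ^ j)"
    using card_image_grid_polynomial[of cl] cl_add_cong by blast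
  obtain A :: real where "\<And>n. 1 \<le> n \<Longrightarrow> real (card (cl ` grid n)) \<le> A * real n ^ p"
    using card_image_grid_upper by blast
  moreover obtain q where "1 \<le> q" "\<And>m. 1 \<le> m \<Longrightarrow> m ^ p \<le> card (cl ` grid (q * m))"
    using card_image_grid_lower by blast
  ultimately show ?thesis using polynomial_growth_limit[OF poly] by blast
qed

text \<open>Translating by \<open>(m, \<dots>, m)\<close> puts both \<open>grid n\<close> and \<open>grid n + b\<close> inside \<open>grid (n + 2 * m)\<close>.\<close>

lemma card_shift_boundary:
  assumes "R \<subseteq> grid n" "inj_on cl R" "cl ` R = cl ` grid n" and b: "\<And>i. \<bar>b $ i\<bar> \<le> int m"
  shows "card {t\<in>R. cl (t + b) \<notin> cl ` grid n} + card (cl ` grid n) \<le> card (cl ` grid (n + 2 * m))"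
proof -
  define z :: "int ^ 'd" where "z = (\<chi> i. int m)"
  define Y where "Y = {t\<in>R. cl (t + b) \<notin> cl ` grid n}"
  have fin: "finite R" using assms(1) finite_grid finite_subset by blast
  have "card Y = card ((\<lambda>t. cl (t + b + z)) ` Y)"
  proof (rule card_image[symmetric], rule inj_onI)
    fix x y assume "x \<in> Y" "y \<in> Y" "cl (x + b + z) = cl (y + b + z)"
    then show "x = y" using assms(2) by (auto simp: cl_eq_iff Y_def inj_on_def)
  qed
  moreover have "card (cl ` grid n) = card ((\<lambda>t. cl (t + z)) ` R)"
  proof -
    have "card ((\<lambda>t. cl (t + z)) ` R) = card R"
      using assms(2) by (intro card_image) (auto simp: cl_eq_iff inj_on_def)
    also have "\<dots> = card (cl ` R)" by (rule card_image[OF assms(2), symmetric])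
    finally show ?thesis using assms(3) by simp
  qed
  \<comment> \<open>The shifted boundary points give new classes: a coincidence would put the class
    of \<open>x + b\<close> back into the image of the box.\<close>
  moreover have "(\<lambda>t. cl (t + b + z)) ` Y \<inter> (\<lambda>t. cl (t + z)) ` R = {}"
  proof -
    have False if "x \<in> Y" "y \<in> R" "cl (x + b + z) = cl (y + z)" for x y
    proof -
      have "cl (x + b) = cl y" using that(3) by (simp add: cl_eq_iff)
      then show False using that(1,2) assms(1) by (auto simp: Y_def)
    qed
    then show ?thesis by blast
  qed
  ultimately have "card Y + card (cl ` grid n) = card ((\<lambda>t. cl (t + b + z)) ` Y \<union> (\<lambda>t. cl (t + z)) ` R)"
    using fin by (subst card_Un_disjoint) (auto simp: Y_def)
  also have "\<dots> \<le> card (cl ` grid (n + 2 * m))"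
  proof (intro card_mono)
    have "t + b + z \<in> grid (n + 2 * m)" "t + z \<in> grid (n + 2 * m)" if "t \<in> R" for t
    proof -
      have "\<And>i. 0 \<le> t $ i \<and> t $ i < int n" using that assms(1) by (auto simp: mem_grid)
      then show "t + b + z \<in> grid (n + 2 * m)" "t + z \<in> grid (n + 2 * m)"
        using b by (auto simp: mem_grid z_def abs_le_iff) (smt (verit))+
    qed
    then show "(\<lambda>t. cl (t + b + z)) ` Y \<union> (\<lambda>t. cl (t + z)) ` R \<subseteq> cl ` grid (n + 2 * m)"
      by (auto simp: Y_def)
  qed simp
  finally show ?thesis by (simp add: Y_def)
qed

text \<open>For one vector \<open>b\<close> the boundary has at most
  \<open>h (n + 2 * m) - h n\<close> points. Since \<open>h n\<close> is asymptotic to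
  \<open>L * n ^ p\<close>, this is negligible against \<open>h n\<close>; finitely many
  \<open>b\<close> are handled by summation.\<close>

lemma boundary_negligible:
  assumes R: "\<And>n. R n \<subseteq> grid n" "\<And>n. inj_on cl (R n)" "\<And>n. cl ` R n = cl ` grid n"
    and "finite B"
  shows "(\<lambda>n. real (card {t\<in>R n. \<exists>b\<in>B. cl (t + b) \<notin> cl ` grid n}) / real (card (R n))) \<longlonglongrightarrow> 0"
proof -
  define h where "h n = card (cl ` grid n)" for n
  have hR: "card (R n) = h n" for n
    using card_image[OF R(2)[of n]] R(3)[of n] by (simp add: h_def)
  obtain L where L: "0 < L" "(\<lambda>n. real (h n) / real n ^ p) \<longlonglongrightarrow> L"
    using card_image_grid_asymp unfolding h_def by blast
  have single: "(\<lambda>n. real (card {t\<in>R n. cl (t + b) \<notin> cl ` grid n}) / real (h n)) \<longlonglongrightarrow> 0" for b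
  proof -
    define m where "m = nat (\<Sum>i\<in>UNIV. \<bar>b $ i\<bar>)"
    have m: "\<bar>b $ i\<bar> \<le> int m" for i
      unfolding m_def using member_le_sum[of i UNIV "\<lambda>i. \<bar>b $ i\<bar>"] by (simp add: sum_nonneg)
    have lim1: "(\<lambda>n. real (h (n + 2 * m)) / real (n + 2 * m) ^ p) \<longlonglongrightarrow> L"
      using LIMSEQ_ignore_initial_segment[OF L(2), of "2 * m"] by simp
    have lim2: "(\<lambda>n. real (n + 2 * m) / real n) \<longlonglongrightarrow> 1"
    proof (rule Lim_transform_eventually)
      show "(\<lambda>n. 1 + real (2 * m) / real n) \<longlonglongrightarrow> 1"
        by (rule tendsto_eq_intros lim_const_over_n refl)+ simp
      show "\<forall>\<^sub>F n in sequentially. 1 + real (2 * m) / real n = real (n + 2 * m) / real n"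
        using eventually_ge_at_top[of 1] by eventually_elim (simp add: field_simps)
    qed
    have "(\<lambda>n. (real (h (n + 2 * m)) / real (n + 2 * m) ^ p) * (real (n + 2 * m) / real n) ^ p
        / (real (h n) / real n ^ p) - 1) \<longlonglongrightarrow> L * 1 ^ p / L - 1"
      using L(1) by (intro tendsto_intros lim1 lim2 L(2)) auto
    then have lim3: "(\<lambda>n. (real (h (n + 2 * m)) / real (n + 2 * m) ^ p) * (real (n + 2 * m) / real n) ^ p
        / (real (h n) / real n ^ p) - 1) \<longlonglongrightarrow> 0" using L(1) by simp
    have hpos: "\<forall>\<^sub>F n in sequentially. 0 < real (h n) / real n ^ p"
      by (rule order_tendstoD(1)[OF L(2,1)])
    show ?thesis
    proof (rule tendsto_sandwich[where f = "\<lambda>_. 0", OF _ _ tendsto_const lim3])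
      show "\<forall>\<^sub>F n in sequentially. real (card {t\<in>R n. cl (t + b) \<notin> cl ` grid n}) / real (h n)
          \<le> (real (h (n + 2 * m)) / real (n + 2 * m) ^ p) * (real (n + 2 * m) / real n) ^ p
            / (real (h n) / real n ^ p) - 1"
        using hpos eventually_ge_at_top[of 1]
      proof eventually_elim
        case (elim n)
        then have pos: "0 < real (h n)" by (auto simp: zero_less_divide_iff)
        have "card {t\<in>R n. cl (t + b) \<notin> cl ` grid n} + h n \<le> h (n + 2 * m)"
          unfolding h_def by (rule card_shift_boundary[OF R m])
        then have "real (card {t\<in>R n. cl (t + b) \<notin> cl ` grid n}) \<le> real (h (n + 2 * m)) - real (h n)"
          by linarith
        then have "real (card {t\<in>R n. cl (t + b) \<notin> cl ` grid n}) / real (h n)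
            \<le> (real (h (n + 2 * m)) - real (h n)) / real (h n)"
          by (rule divide_right_mono) simp
        also have "\<dots> = real (h (n + 2 * m)) / real (h n) - 1"
          using pos by (simp add: diff_divide_distrib)
        also have "real (h (n + 2 * m)) / real (h n) =
            (real (h (n + 2 * m)) / real (n + 2 * m) ^ p) * (real (n + 2 * m) / real n) ^ p
              / (real (h n) / real n ^ p)"
          using elim by (simp add: power_divide)
        finally show ?case .
      qed
    qed simp
  qed
  have lim: "(\<lambda>n. \<Sum>b\<in>B. real (card {t\<in>R n. cl (t + b) \<notin> cl ` grid n}) / real (h n)) \<longlonglongrightarrow> 0"
    using tendsto_sum[of B, OF single] by simp
  show ?thesis
  proof (rule tendsto_sandwich[where f = "\<lambda>_. 0", OF _ _ tendsto_const lim])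
    show "\<forall>\<^sub>F n in sequentially. real (card {t\<in>R n. \<exists>b\<in>B. cl (t + b) \<notin> cl ` grid n}) / real (card (R n))
        \<le> (\<Sum>b\<in>B. real (card {t\<in>R n. cl (t + b) \<notin> cl ` grid n}) / real (h n))"
    proof (intro always_eventually allI)
      fix n
      have "{t\<in>R n. \<exists>b\<in>B. cl (t + b) \<notin> cl ` grid n} = (\<Union>b\<in>B. {t\<in>R n. cl (t + b) \<notin> cl ` grid n})"
        by blast
      then have "card {t\<in>R n. \<exists>b\<in>B. cl (t + b) \<notin> cl ` grid n} \<le> (\<Sum>b\<in>B. card {t\<in>R n. cl (t + b) \<notin> cl ` grid n})"
        using card_UN_le[OF \<open>finite B\<close>] by simp
      then have "real (card {t\<in>R n. \<exists>b\<in>B. cl (t + b) \<notin> cl ` grid n}) \<le> real (\<Sum>b\<in>B. card {t\<in>R n. cl (t + b) \<notin> cl ` grid n})"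
        by (simp only: of_nat_le_iff)
      then show "real (card {t\<in>R n. \<exists>b\<in>B. cl (t + b) \<notin> cl ` grid n}) / real (card (R n))
        \<le> (\<Sum>b\<in>B. real (card {t\<in>R n. cl (t + b) \<notin> cl ` grid n}) / real (h n))"
        by (simp add: hR divide_right_mono flip: sum_divide_distrib)
    qed
  qed simp
qed

end

section \<open>From the group of transformations to a lattice quotient\<close>

lemma action_group_group:
  fixes \<phi> :: "'g::ab_group_add \<Rightarrow> 's \<Rightarrow> 's"
  assumes "nonsingular_action \<mu> \<phi>"
  shows "group (action_group \<mu> \<phi>)" "carrier (action_group \<mu> \<phi>) = range (\<lambda>t. ae_class \<mu> (\<phi> t))"
    "\<one>\<^bsub>action_group \<mu> \<phi>\<^esub> = ae_class \<mu> (\<phi> 0)"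
    "inv\<^bsub>action_group \<mu> \<phi>\<^esub> (ae_class \<mu> (\<phi> t)) = ae_class \<mu> (\<phi> (- t))"
proof -
  show carrier: "carrier (action_group \<mu> \<phi>) = range (\<lambda>t. ae_class \<mu> (\<phi> t))"
    by (simp add: action_group_def)
  have "AE s in \<mu>. s = \<phi> 0 s"
    using assms by (auto simp: nonsingular_action_def measurable_action_def intro!: AE_I2)
  then show one: "\<one>\<^bsub>action_group \<mu> \<phi>\<^esub> = ae_class \<mu> (\<phi> 0)"
    by (simp add: action_group_def transformation_group_def ae_class_cong)
  note mult = action_group_mult[OF assms]
  show grp: "group (action_group \<mu> \<phi>)"
  proof (rule groupI)
    fix x assume "x \<in> carrier (action_group \<mu> \<phi>)"
    then obtain t where "x = ae_class \<mu> (\<phi> t)" using carrier by blast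
    then have "ae_class \<mu> (\<phi> (- t)) \<otimes>\<^bsub>action_group \<mu> \<phi>\<^esub> x = \<one>\<^bsub>action_group \<mu> \<phi>\<^esub>"
      by (simp add: mult one)
    then show "\<exists>y\<in>carrier (action_group \<mu> \<phi>). y \<otimes>\<^bsub>action_group \<mu> \<phi>\<^esub> x = \<one>\<^bsub>action_group \<mu> \<phi>\<^esub>"
      using carrier by blast
  qed (auto simp: carrier one mult add.assoc)
  show "inv\<^bsub>action_group \<mu> \<phi>\<^esub> (ae_class \<mu> (\<phi> t)) = ae_class \<mu> (\<phi> (- t))"
    by (rule group.inv_equality[OF grp]) (auto simp: carrier one mult)
qed

text \<open>A basis of the free part is pulled back from the free abelian group by the inverse
  \<open>hi\<close> of the isomorphism and lifted to the lattice by the section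
  \<open>\<Psi>\<close>. Since \<open>cl\<close> undoes \<open>\<Psi>\<close>, independence modulo
  the kernel is inherited from the free abelian group.\<close>

lemma effective_free_subgroup_lattice:
  fixes \<phi> :: "int ^ 'd \<Rightarrow> 's \<Rightarrow> 's"
  assumes act: "nonsingular_action \<mu> \<phi>" and eff: "effective_free_subgroup \<mu> \<phi> F p"
  shows "\<exists>K V a. lattice_quotient (\<lambda>t. ae_class \<mu> (\<phi> t)) K V a p \<and> F = range (lin_comb p a)"
proof -
  define cl where "cl t = ae_class \<mu> (\<phi> t)" for t
  define A where "A = action_group \<mu> \<phi>"
  define K where "K = {t. cl t = cl 0}"
  note mult = action_group_mult[OF act, folded A_def cl_def]
  note grp = action_group_group[OF act, folded A_def cl_def]
  have cl_cong: "cl (x + z) = cl (y + z)" if "cl x = cl y" for x y z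
    using mult[of x z] mult[of y z] that by simp
  have cl_eq: "cl x = cl y \<longleftrightarrow> x - y \<in> K" for x y
    using cl_cong[of x y "- y"] cl_cong[of "x - y" 0 y] by (auto simp: K_def)
  have K: "add_subgroup K"
    unfolding add_subgroup_def
  proof (intro conjI ballI)
    fix x y assume "x \<in> K" "y \<in> K"
    then have "cl x = cl y" by (simp add: K_def)
    then show "x - y \<in> K" using cl_eq by blast
  qed (simp add: K_def)
  obtain Fbar Nbar \<Psi> where ds: "internal_direct_sum A Fbar Nbar"
    and free: "free_abelian_of_rank (A\<lparr>carrier := Fbar\<rparr>) p" and finN: "finite Nbar"
    and hom: "\<Psi> \<in> hom (A\<lparr>carrier := Fbar\<rparr>) additive_group" and inj: "inj_on \<Psi> Fbar"
    and sect: "\<And>C. C \<in> Fbar \<Longrightarrow> cl (\<Psi> C) = C" and F: "F = \<Psi> ` Fbar"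
    using eff unfolding effective_free_subgroup_def A_def cl_def by blast
  have subF: "subgroup Fbar A" and subN: "subgroup Nbar A" and sum: "Fbar <#>\<^bsub>A\<^esub> Nbar = carrier A"
    using ds by (auto simp: internal_direct_sum_def)
  obtain h where h: "h \<in> iso (A\<lparr>carrier := Fbar\<rparr>) (free_Abelian_group {..<p})"
    using free by (auto simp: free_abelian_of_rank_def is_iso_def)
  \<comment> \<open>The carrier of \<open>free_Abelian_group {..<p}\<close>: finitely supported
    integer functions that vanish from \<open>p\<close> on.\<close>
  define H where "H = {c :: nat \<Rightarrow>\<^sub>0 int. Poly_Mapping.keys c \<subseteq> {..<p}}"
  have bij: "bij_betw h Fbar H" and hadd: "\<And>x y. x \<in> Fbar \<Longrightarrow> y \<in> Fbar \<Longrightarrow> h (x \<otimes>\<^bsub>A\<^esub> y) = h x + h y"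
    using h by (auto simp: iso_def hom_def free_Abelian_group_def H_def)
  define hi where "hi = inv_into Fbar h"
  have hi: "\<And>c. c \<in> H \<Longrightarrow> hi c \<in> Fbar" "\<And>c. c \<in> H \<Longrightarrow> h (hi c) = c" "\<And>x. x \<in> Fbar \<Longrightarrow> hi (h x) = x"
    using bij_betw_inv_into_right[OF bij] bij_betw_inv_into_left[OF bij] bij_betwE[OF bij_betw_inv_into[OF bij]]
    by (auto simp: hi_def)
  have hi_add: "hi (c + d) = hi c \<otimes>\<^bsub>A\<^esub> hi d" if "c \<in> H" "d \<in> H" for c d
  proof -
    have "hi c \<otimes>\<^bsub>A\<^esub> hi d \<in> Fbar" using subgroup.m_closed[OF subF] hi(1) that by blast
    moreover have "h (hi c \<otimes>\<^bsub>A\<^esub> hi d) = c + d" using hadd hi that by simp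
    ultimately show ?thesis using hi(3) by metis
  qed
  define \<eta> where "\<eta> c = \<Psi> (hi c)" for c
  have \<eta>_add: "\<eta> (c + d) = \<eta> c + \<eta> d" if "c \<in> H" "d \<in> H" for c d
    using hom that hi(1) by (auto simp: \<eta>_def hi_add hom_def additive_group_def)
  have cl_\<eta>: "cl (\<eta> c) = hi c" if "c \<in> H" for c
    using sect hi(1) that by (simp add: \<eta>_def)
  have H_add: "c + d \<in> H" if "c \<in> H" "d \<in> H" for c d
    using that Poly_Mapping.keys_add[of c d] by (auto simp: H_def)
  have H_cmul: "frag_cmul k c \<in> H" if "c \<in> H" for k c
    using that by (auto simp: H_def)
  have H_of: "frag_of j \<in> H" if "j < p" for j
    using that by (simp add: H_def keys_frag_of)
  have H0: "0 \<in> H" by (simp add: H_def)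
  have \<eta>_cmul: "\<eta> (frag_cmul k c) = k *s \<eta> c" if "c \<in> H" for k c
    by (rule additive_on_scale[where H = H and scale = frag_cmul])
      (auto simp: \<eta>_add H_cmul frag_cmul_distrib that)
  have \<eta>0: "\<eta> 0 = 0" using \<eta>_add[OF H0 H0] by simp
  define a where "a j = \<eta> (frag_of j)" for j
  define x where "x m = (\<Sum>j<p. frag_cmul (m j) (frag_of j))" for m :: "nat \<Rightarrow> int"
  \<comment> \<open>Induction on the number of summands, because additivity of \<open>\<eta>\<close>
    is available only within \<open>H\<close>.\<close>
  have x_gen: "(\<Sum>j<r. frag_cmul (m j) (frag_of j)) \<in> H \<and>
      \<eta> (\<Sum>j<r. frag_cmul (m j) (frag_of j)) = lin_comb r a m" if "r \<le> p" for r m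
    using that
  proof (induction r)
    case 0
    then show ?case by (simp add: H0 \<eta>0 lin_comb_def)
  next
    case (Suc r)
    then show ?case
      using H_of[of r] by (simp add: H_add H_cmul \<eta>_add \<eta>_cmul lin_comb_def a_def)
  qed
  have x: "x m \<in> H" "\<eta> (x m) = lin_comb p a m" for m
    using x_gen[of p m] by (auto simp: x_def)
  have lookup_x: "Poly_Mapping.lookup (x m) j = (if j < p then m j else 0)" for m j
    by (simp add: x_def lookup_sum if_distrib cong: if_cong)
  have x_surj: "c = x (Poly_Mapping.lookup c)" if "c \<in> H" for c
  proof (rule poly_mapping_eqI)
    fix j show "Poly_Mapping.lookup c j = Poly_Mapping.lookup (x (Poly_Mapping.lookup c)) j"
      using that unfolding lookup_x by (auto simp: H_def in_keys_iff subset_iff)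
  qed
  have F_eq: "F = range (lin_comb p a)"
  proof -
    have "Fbar = hi ` H" using bij hi by (auto simp: bij_betw_def image_iff)
    then have "F = \<eta> ` H" by (auto simp: F \<eta>_def)
    also have "\<dots> = range (lin_comb p a)"
      using x x_surj by (auto simp: image_iff) metis+
    finally show ?thesis .
  qed
  have independent: "m j = 0" if "lin_comb p a m \<in> K" "j < p" for m j
  proof -
    \<comment> \<open>On \<open>H\<close>, \<open>cl\<close> maps \<open>\<eta> c\<close> to
      \<open>hi c\<close>; so a combination in the kernel has the same image as 0, and
      \<open>hi\<close> is injective on \<open>H\<close>.\<close>
    have "hi (x m) = hi 0"
      using that(1) cl_\<eta>[OF x(1)] cl_\<eta>[OF H0] by (simp add: x(2) K_def \<eta>0)
    then have "x m = 0" using hi(2)[OF x(1)] hi(2)[OF H0] by metis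
    then show ?thesis using lookup_x[of m j] that(2) by simp
  qed
  define V where "V = {t. cl t \<in> Nbar}"
  have V: "add_subgroup V"
    unfolding add_subgroup_def
  proof (intro conjI ballI)
    show "0 \<in> V" using subgroup.one_closed[OF subN] grp(3) by (simp add: V_def)
    fix s t assume "s \<in> V" "t \<in> V"
    then have "cl s \<otimes>\<^bsub>A\<^esub> inv\<^bsub>A\<^esub> (cl t) \<in> Nbar"
      using subgroup.m_closed[OF subN] subgroup.m_inv_closed[OF subN] by (simp add: V_def)
    then show "s - t \<in> V" by (simp add: grp(4) mult V_def)
  qed
  have finV: "finite (cl ` V)" by (rule finite_subset[OF _ finN]) (auto simp: V_def)
  \<comment> \<open>\<open>cl t\<close> factors into a free and a finite part;
    \<open>\<Psi> C\<close> lifts the first to a combination of the \<open>a j\<close>, and any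
    preimage of the second lies in \<open>V\<close>.\<close>
  have decompose: "\<exists>m. \<exists>v\<in>V. t - lin_comb p a m - v \<in> K" for t
  proof -
    have "cl t \<in> Fbar <#>\<^bsub>A\<^esub> Nbar" using sum grp(2) by blast
    then obtain C D where CD: "C \<in> Fbar" "D \<in> Nbar" "cl t = C \<otimes>\<^bsub>A\<^esub> D"
      by (auto simp: set_mult_def)
    obtain v where v: "D = cl v" using subgroup.subset[OF subN] CD(2) grp(2) by blast
    have "\<Psi> C \<in> F" using CD(1) F by blast
    then obtain m where m: "\<Psi> C = lin_comb p a m" using F_eq by blast
    have "cl t = cl (lin_comb p a m + v)" using CD(3) sect[OF CD(1)] mult[of "\<Psi> C" v] v m by simp
    then have "t - (lin_comb p a m + v) \<in> K" using cl_eq by blast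
    then have "t - lin_comb p a m - v \<in> K" by (simp add: diff_diff_eq)
    moreover have "v \<in> V" using CD(2) v by (simp add: V_def)
    ultimately show ?thesis by blast
  qed
  have "lattice_quotient cl K V a p"
    by (unfold_locales) (use cl_eq K V finV decompose independent in auto)
  then show ?thesis using F_eq unfolding cl_def by blast
qed

section \<open>Orbit maxima\<close>

text \<open>Each of the \<open>k\<close> indices attaining the maximum \<open>M\<close> contributes
  \<open>M / k\<close>, all others contribute 0.\<close>

lemma Max_eq_sum_argmax:
  fixes f :: "'a \<Rightarrow> real"
  assumes R: "finite R" "R \<noteq> {}"
  shows "Max (f ` R) = (\<Sum>t\<in>R. f t * (if \<forall>r\<in>R. f r \<le> f t then 1 / real (card {r\<in>R. f r = f t}) else 0))"
proof -
  define M where "M = Max (f ` R)"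
  have le: "f r \<le> M" if "r \<in> R" for r
    using R(1) that by (simp add: M_def)
  have "M \<in> f ` R" unfolding M_def using R by (intro Max_in) auto
  then obtain t0 where t0: "t0 \<in> R" "f t0 = M" by blast
  define T where "T = {t\<in>R. f t = M}"
  have T: "finite T" "T \<noteq> {}" "T \<subseteq> R" using R(1) t0 by (auto simp: T_def)
  have "f t * (if \<forall>r\<in>R. f r \<le> f t then 1 / real (card {r\<in>R. f r = f t}) else 0)
        = (if t \<in> T then M / real (card T) else 0)" if t: "t \<in> R" for t
  proof (cases "f t = M")
    case True
    then have "\<forall>r\<in>R. f r \<le> f t" "{r\<in>R. f r = f t} = T" "t \<in> T" using le t by (auto simp: T_def)
    then show ?thesis using True by simp
  next
    case False
    then have "\<not> f t0 \<le> f t" using le[OF t] t0(2) by simp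
    moreover have "t \<notin> T" using False by (simp add: T_def)
    ultimately show ?thesis using t0(1) by auto
  qed
  then have "(\<Sum>t\<in>R. f t * (if \<forall>r\<in>R. f r \<le> f t then 1 / real (card {r\<in>R. f r = f t}) else 0))
      = (\<Sum>t\<in>R. if t \<in> T then M / real (card T) else 0)" by (rule sum.cong[OF refl])
  also have "\<dots> = (\<Sum>t\<in>T. M / real (card T))"
    using R(1) T(3) by (simp add: sum.inter_restrict[symmetric] Int_absorb1)
  also have "\<dots> = M" using T(1,2) by simp
  finally show ?thesis by (simp add: M_def)
qed

section \<open>Change of variables and the Radon-Nikodym cocycle\<close>

text \<open>\<open>g\<close> plays the role of \<open>\<bar>f\<bar> powr \<alpha>\<close>.
  Countability of the group lets almost sure identities hold for all group elements at once.\<close>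

locale weighted_action = sigma_finite_measure \<mu> for \<mu> :: "'s measure" +
  fixes \<phi> :: "'g::{ab_group_add,countable} \<Rightarrow> 's \<Rightarrow> 's" and g :: "'s \<Rightarrow> real"
  assumes act: "nonsingular_action \<mu> \<phi>"
    and g_meas [measurable]: "g \<in> borel_measurable \<mu>"
    and g_nonneg: "0 \<le> g s"
    and g_int: "integrable \<mu> g"
begin

definition cl :: "'g \<Rightarrow> ('s \<Rightarrow> 's) set" where
  "cl t = ae_class \<mu> (\<phi> t)"

definition w :: "'g \<Rightarrow> 's \<Rightarrow> real" where
  "w t s = enn2real (RN_deriv \<mu> (meas_comp \<mu> (\<phi> t)) s)"

definition G :: "'g \<Rightarrow> 's \<Rightarrow> real" where
  "G t s = w t s * g (\<phi> t s)"

lemma mact: "measurable_action \<mu> \<phi>"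
  using act by (simp add: nonsingular_action_def)

lemma phi_meas [measurable]: "\<phi> t \<in> measurable \<mu> \<mu>"
  using mact by (simp add: measurable_action_def)

lemma phi_0: "s \<in> space \<mu> \<Longrightarrow> \<phi> 0 s = s"
  and phi_add: "s \<in> space \<mu> \<Longrightarrow> \<phi> u (\<phi> v s) = \<phi> (u + v) s"
  using mact by (auto simp: measurable_action_def)

lemma w_meas [measurable]: "w t \<in> borel_measurable \<mu>"
  by (simp add: w_def [abs_def])

lemma G_meas [measurable]: "G t \<in> borel_measurable \<mu>"
  by (simp add: G_def [abs_def])

lemma w_nonneg: "0 \<le> w t s"
  by (simp add: w_def)

lemma G_nonneg: "0 \<le> G t s"
  by (simp add: G_def w_nonneg g_nonneg)

lemma AE_phi: "AE s in \<mu>. R s \<Longrightarrow> AE s in \<mu>. R (\<phi> t s)"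
  by (rule AE_nonsingular_compose[OF phi_meas nonsingular_action_null_sets[OF act]])

lemma AE_phi_all: "AE s in \<mu>. R s \<Longrightarrow> AE s in \<mu>. \<forall>t. R (\<phi> t s)"
  by (simp add: AE_all_countable AE_phi)

text \<open>\<open>w t\<close> is the density of the image of \<open>\<mu>\<close> under
  \<open>\<phi> (- t)\<close>; integrating against that image lets \<open>\<phi> t\<close> and
  \<open>\<phi> (- t)\<close> cancel.\<close>

lemma nn_integral_change_variable:
  assumes [measurable]: "h \<in> borel_measurable \<mu>"
  shows "(\<integral>\<^sup>+s. ennreal (w t s) * h (\<phi> t s) \<partial>\<mu>) = (\<integral>\<^sup>+s. h s \<partial>\<mu>)"
proof -
  let ?N = "distr \<mu> \<mu> (\<phi> (- t))"
  have mc: "meas_comp \<mu> (\<phi> t) = ?N" by (rule meas_comp_eq_distr[OF mact])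
  have ac: "absolutely_continuous \<mu> ?N" using act by (simp add: nonsingular_action_def flip: mc)
  have "distr ?N \<mu> (\<phi> t) = distr \<mu> \<mu> (\<phi> t \<circ> \<phi> (- t))" by (rule distr_distr) simp_all
  also have "\<dots> = distr \<mu> \<mu> (\<lambda>s. s)"
    by (rule distr_cong) (simp_all add: phi_add phi_0)
  finally have "distr ?N \<mu> (\<phi> t) = \<mu>" by simp
  \<comment> \<open>Pushing the image measure forward again gives \<open>\<mu>\<close>, so it is
    sigma-finite, its density is finite almost everywhere and \<open>enn2real\<close> loses
    nothing.\<close>
  then have sf: "sigma_finite_measure ?N"
    using sigma_finite_measure_distr[of ?N \<mu> "\<phi> t"] sigma_finite_measure_axioms by simp
  have fin: "AE s in \<mu>. RN_deriv \<mu> ?N s \<noteq> \<infinity>"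
    by (rule RN_deriv_finite[OF sf ac]) simp
  have "(\<integral>\<^sup>+s. ennreal (w t s) * h (\<phi> t s) \<partial>\<mu>) = (\<integral>\<^sup>+s. RN_deriv \<mu> ?N s * h (\<phi> t s) \<partial>\<mu>)"
    using fin by (intro nn_integral_cong_AE) (auto simp: w_def mc less_top elim!: eventually_mono)
  also have "\<dots> = (\<integral>\<^sup>+s. h (\<phi> t s) \<partial>?N)"
    by (rule RN_deriv_nn_integral[OF ac, symmetric]) simp_all
  also have "\<dots> = (\<integral>\<^sup>+s. h (\<phi> t (\<phi> (- t) s)) \<partial>\<mu>)"
    by (rule nn_integral_distr) simp_all
  also have "\<dots> = (\<integral>\<^sup>+s. h s \<partial>\<mu>)"
    by (rule nn_integral_cong) (simp add: phi_add phi_0)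
  finally show ?thesis .
qed

text \<open>The chain rule for densities: two changes of variable show that the product on the right
  is a density of the image of \<open>\<mu>\<close> under \<open>\<phi> (- (u + v))\<close>, and
  densities are unique.\<close>

lemma w_cocycle: "AE s in \<mu>. w (u + v) s = w v s * w u (\<phi> v s)"
proof -
  let ?f = "\<lambda>s. ennreal (w v s * w u (\<phi> v s))"
  let ?N = "distr \<mu> \<mu> (\<phi> (- (u + v)))"
  have "density \<mu> ?f = ?N"
  proof (rule measure_eqI)
    fix A assume "A \<in> sets (density \<mu> ?f)"
    then have [measurable]: "A \<in> sets \<mu>" by simp
    have "emeasure (density \<mu> ?f) A = (\<integral>\<^sup>+s. ?f s * indicator A s \<partial>\<mu>)"
      by (rule emeasure_density) simp_all
    also have "\<dots> = (\<integral>\<^sup>+s. ennreal (w v s) * (ennreal (w u (\<phi> v s)) * indicator A (\<phi> (- v) (\<phi> v s))) \<partial>\<mu>)"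
      by (rule nn_integral_cong) (simp add: phi_add phi_0 ennreal_mult w_nonneg mult.assoc)
    also have "\<dots> = (\<integral>\<^sup>+s. ennreal (w u s) * indicator A (\<phi> (- v) s) \<partial>\<mu>)"
      by (rule nn_integral_change_variable) measurable
    also have "\<dots> = (\<integral>\<^sup>+s. ennreal (w u s) * indicator A (\<phi> (- (u + v)) (\<phi> u s)) \<partial>\<mu>)"
      by (rule nn_integral_cong) (simp add: phi_add algebra_simps)
    also have "\<dots> = (\<integral>\<^sup>+s. indicator A (\<phi> (- (u + v)) s) \<partial>\<mu>)"
      by (rule nn_integral_change_variable) measurable
    also have "\<dots> = (\<integral>\<^sup>+s. indicator A s \<partial>?N)"
      by (rule nn_integral_distr[symmetric]) simp_all
    also have "\<dots> = emeasure ?N A" by simp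
    finally show "emeasure (density \<mu> ?f) A = emeasure ?N A" .
  qed simp
  then have "AE s in \<mu>. ?f s = RN_deriv \<mu> ?N s"
    by (rule RN_deriv_unique[rotated]) simp
  then show ?thesis
  proof eventually_elim
    case (elim s)
    have "w (u + v) s = enn2real (?f s)"
      unfolding elim w_def[of "u + v"] meas_comp_eq_distr[OF mact] ..
    then show ?case by (simp add: w_nonneg)
  qed
qed

lemma cl_eq_iff_AE: "cl x = cl y \<longleftrightarrow> (AE s in \<mu>. \<phi> x s = \<phi> y s)"
proof
  assume "cl x = cl y"
  moreover have "\<phi> x \<in> cl x" by (simp add: cl_def ae_class_def)
  ultimately show "AE s in \<mu>. \<phi> x s = \<phi> y s" by (simp add: cl_def ae_class_def)
qed (simp add: cl_def ae_class_cong)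

lemma cl_cong: "cl x = cl y \<Longrightarrow> cl (x + z) = cl (y + z)"
  using action_group_mult[OF act, of x z] action_group_mult[OF act, of y z] by (simp add: cl_def)

lemma cl_add_right_iff: "cl (x + z) = cl (y + z) \<longleftrightarrow> cl x = cl y"
  using cl_cong[of "x + z" "y + z" "- z"] cl_cong[of x y z] by auto

text \<open>If \<open>\<phi> t\<close> is the identity almost everywhere, so is
  \<open>\<phi> (- t)\<close>, and the image measure is \<open>\<mu>\<close> itself.\<close>

lemma w_trivial:
  assumes "cl t = cl 0"
  shows "AE s in \<mu>. w t s = 1"
proof -
  have "cl (- t) = cl 0" using cl_cong[OF assms, of "- t"] by simp
  then have AE: "AE s in \<mu>. \<phi> (- t) s = s"
    unfolding cl_eq_iff_AE using phi_0 by (auto elim: AE_mp intro!: AE_I2)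
  have "density \<mu> (\<lambda>_. 1) = distr \<mu> \<mu> (\<phi> (- t))"
  proof (rule measure_eqI)
    fix A assume "A \<in> sets (density \<mu> (\<lambda>_. 1))"
    then have [measurable]: "A \<in> sets \<mu>" by simp
    have "emeasure \<mu> A = emeasure \<mu> (\<phi> (- t) -` A \<inter> space \<mu>)"
      using AE sets.sets_into_space[OF \<open>A \<in> sets \<mu>\<close>]
      by (intro emeasure_eq_AE) (auto elim!: eventually_mono)
    then show "emeasure (density \<mu> (\<lambda>_. 1)) A = emeasure (distr \<mu> \<mu> (\<phi> (- t))) A"
      by (simp add: density_1 emeasure_distr)
  qed simp
  then have "AE s in \<mu>. 1 = RN_deriv \<mu> (distr \<mu> \<mu> (\<phi> (- t))) s"
    by (rule RN_deriv_unique[rotated]) simp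
  then show ?thesis
  proof eventually_elim
    case (elim s)
    then show ?case by (simp add: w_def meas_comp_eq_distr[OF mact] flip: elim)
  qed
qed

text \<open>Gathers the almost sure identities for all group elements, so that arguments along an
  orbit can be pointwise.\<close>

definition regular :: "'s \<Rightarrow> bool" where
  "regular s \<longleftrightarrow> s \<in> space \<mu> \<and> (\<forall>v. 0 < w v s) \<and> (\<forall>u v. G (u + v) s = w v s * G u (\<phi> v s)) \<and>
     (\<forall>x y. cl x = cl y \<longrightarrow> G x s = G y s) \<and> G 0 s = g s"

lemma AE_regular: "AE s in \<mu>. regular s"
proof -
  have coc: "AE s in \<mu>. \<forall>u v. w (u + v) s = w v s * w u (\<phi> v s)"
    by (simp add: AE_all_countable w_cocycle)
  have w0: "AE s in \<mu>. w 0 s = 1" by (rule w_trivial) simp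
  have "AE s in \<mu>. G k s = g s" if "cl k = cl 0" for k
    using w_trivial[OF that] that[unfolded cl_eq_iff_AE] AE_space
    by eventually_elim (simp add: G_def phi_0)
  then have triv: "AE s in \<mu>. \<forall>k. cl k = cl 0 \<longrightarrow> G k s = g s"
    by (simp add: AE_all_countable)
  show ?thesis
    using coc w0 triv AE_phi_all[OF triv] AE_space
  proof eventually_elim
    case (elim s)
    \<comment> \<open>By the cocycle identity \<open>w v s\<close> is a factor of
      \<open>w 0 s = 1\<close>, so it cannot vanish.\<close>
    have pos: "0 < w v s" for v
    proof -
      have "w (- v + v) s = w v s * w (- v) (\<phi> v s)" using elim(1) by blast
      then have "w v s \<noteq> 0" using elim(2) by auto
      then show ?thesis using w_nonneg[of v s] by simp
    qed
    have G: "G (u + v) s = w v s * G u (\<phi> v s)" for u v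
      using elim(1,5) by (simp add: G_def phi_add)
    \<comment> \<open>\<open>x - y\<close> acts trivially, and this is applied at the point
      \<open>\<phi> y s\<close>; hence the kernel identity is also secured along the orbit.\<close>
    have cong: "G x s = G y s" if "cl x = cl y" for x y
    proof -
      have "cl (x - y) = cl 0" using cl_cong[OF that, of "- y"] by simp
      then have "G (x - y) (\<phi> y s) = g (\<phi> y s)" using elim(4) by blast
      then show ?thesis using G[of "x - y" y] by (simp add: G_def)
    qed
    show ?case
      unfolding regular_def using elim(3,5) by (intro conjI allI impI pos G cong) auto
  qed
qed

section \<open>Shares of the maximum\<close>

text \<open>
  The share of the maximum over \<open>S\<close> allotted to the index \<open>0\<close>, ties being split equally. It is \<open>0\<close>
  when there are infinitely many ties, because then \<open>card\<close> is \<open>0\<close> and \<open>1 / 0 = 0\<close>.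
\<close>

definition \<kappa> :: "'g set \<Rightarrow> 's \<Rightarrow> real" where
  "\<kappa> S s = (if \<forall>r\<in>S. G r s \<le> g s then 1 / real (card {r\<in>S. G r s = g s}) else 0)"

definition J :: "'g set \<Rightarrow> real" where
  "J S = (\<integral>s. g s * \<kappa> S s \<partial>\<mu>)"

lemma kappa_nonneg: "0 \<le> \<kappa> S s" and kappa_le_1: "\<kappa> S s \<le> 1"
proof -
  have "1 / real k \<le> 1" for k by (cases k) auto
  then show "\<kappa> S s \<le> 1" by (simp add: \<kappa>_def)
qed (simp add: \<kappa>_def)

lemma kappa_meas_finite:
  assumes "finite S"
  shows "\<kappa> S \<in> borel_measurable \<mu>"
proof -
  have "\<kappa> S = (\<lambda>s. if \<forall>r\<in>S. G r s \<le> g s then 1 / (\<Sum>r\<in>S. if G r s = g s then 1 else 0) else 0)"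
    using assms by (simp add: \<kappa>_def fun_eq_iff sum.If_cases Int_def)
  also have "\<dots> \<in> borel_measurable \<mu>" using assms by measurable
  finally show ?thesis .
qed

text \<open>If some \<open>G r s\<close> exceeds \<open>g s\<close>, a single index detects it and
  both sides are eventually 0. Otherwise the number of ties grows to that of \<open>D\<close>; if it
  grows without bound the reciprocals tend to 0, which is the value that \<open>1 / 0 = 0\<close>
  gives to infinitely many ties.\<close>

lemma kappa_tendsto:
  assumes S: "\<And>m. S m \<subseteq> D" and ev: "\<And>X. finite X \<Longrightarrow> X \<subseteq> D \<Longrightarrow> \<forall>\<^sub>F m in sequentially. X \<subseteq> S m"
    and fin: "\<And>m. finite (S m)"
  shows "(\<lambda>m. \<kappa> (S m) s) \<longlonglongrightarrow> \<kappa> D s"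
proof (cases "\<forall>r\<in>D. G r s \<le> g s")
  case False
  then obtain r where r: "r \<in> D" "\<not> G r s \<le> g s" by blast
  have "\<forall>\<^sub>F m in sequentially. {r} \<subseteq> S m" using r by (intro ev) auto
  then have "\<forall>\<^sub>F m in sequentially. \<kappa> (S m) s = \<kappa> D s"
    by eventually_elim (use r in \<open>auto simp: \<kappa>_def\<close>)
  then show ?thesis by (rule tendsto_eventually)
next
  case True
  define T where "T = {r\<in>D. G r s = g s}"
  have k: "\<kappa> (S m) s = 1 / real (card (T \<inter> S m))" for m
  proof -
    have "{r\<in>S m. G r s = g s} = T \<inter> S m" using S by (auto simp: T_def)
    then show ?thesis using True S by (auto simp: \<kappa>_def)
  qed
  have kD: "\<kappa> D s = 1 / real (card T)" using True by (simp add: \<kappa>_def T_def)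
  show ?thesis
  proof (cases "finite T")
    case fT: True
    have "\<forall>\<^sub>F m in sequentially. T \<subseteq> S m" using fT by (intro ev) (auto simp: T_def)
    then have "\<forall>\<^sub>F m in sequentially. \<kappa> (S m) s = \<kappa> D s"
      by eventually_elim (simp add: k kD Int_absorb2)
    then show ?thesis by (rule tendsto_eventually)
  next
    case fT: False
    have "filterlim (\<lambda>m. real (card (T \<inter> S m))) at_top sequentially"
      unfolding filterlim_at_top
    proof
      fix Z :: real
      obtain X where X: "X \<subseteq> T" "finite X" "card X = nat \<lceil>Z\<rceil>"
        using infinite_arbitrarily_large[OF fT] by blast
      have "\<forall>\<^sub>F m in sequentially. X \<subseteq> S m" using X by (intro ev) (auto simp: T_def)
      then show "\<forall>\<^sub>F m in sequentially. Z \<le> real (card (T \<inter> S m))"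
      proof eventually_elim
        case (elim m)
        then have "card X \<le> card (T \<inter> S m)" using X fin by (intro card_mono) auto
        then show ?case using X(3) by linarith
      qed
    qed
    then have "(\<lambda>m. 1 / real (card (T \<inter> S m))) \<longlonglongrightarrow> 0"
      by (intro tendsto_divide_0[OF tendsto_const] filterlim_at_top_imp_at_infinity)
    then show ?thesis using fT by (simp add: k kD)
  qed
qed

text \<open>A finite exhaustion of \<open>D\<close>. When \<open>D\<close> contains 0, keeping 0 at
  every stage secures the hypothesis of \<open>J_antimono\<close> on the class of 0.\<close>

definition initial :: "'g set \<Rightarrow> nat \<Rightarrow> 'g set" where
  "initial D m = {d\<in>D. d = 0 \<or> to_nat d < m}"

lemma initial_subset: "initial D m \<subseteq> D"
  by (auto simp: initial_def)

lemma finite_initial: "finite (initial D m)"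
proof -
  have "finite (to_nat -` {..<m} :: 'g set)" by (intro finite_vimageI) (auto intro: inj_on_to_nat)
  then show ?thesis
    by (rule finite_subset[rotated, OF finite.insertI[of _ 0]]) (auto simp: initial_def)
qed

lemma eventually_subset_initial:
  assumes "finite X" "X \<subseteq> D"
  shows "\<forall>\<^sub>F m in sequentially. X \<subseteq> initial D m"
proof -
  have "\<forall>\<^sub>F m in sequentially. \<forall>x\<in>X. to_nat x < m"
    using assms(1) by (intro eventually_ball_finite) (auto intro: eventually_gt_at_top)
  then show ?thesis by eventually_elim (use assms(2) in \<open>auto simp: initial_def\<close>)
qed

lemma kappa_initial_tendsto: "(\<lambda>m. \<kappa> (initial D m) s) \<longlonglongrightarrow> \<kappa> D s"
  by (rule kappa_tendsto[OF initial_subset eventually_subset_initial finite_initial])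

lemma kappa_meas [measurable]: "\<kappa> D \<in> borel_measurable \<mu>"
  by (rule borel_measurable_LIMSEQ_real[OF kappa_initial_tendsto kappa_meas_finite[OF finite_initial]])

lemma J_integrable: "integrable \<mu> (\<lambda>s. g s * \<kappa> S s)"
  by (rule Bochner_Integration.integrable_bound[OF g_int])
    (auto simp: abs_mult kappa_nonneg g_nonneg kappa_le_1 mult_left_le)

lemma J_nonneg: "0 \<le> J S"
  unfolding J_def by (intro integral_nonneg_AE AE_I2) (simp add: g_nonneg kappa_nonneg)

lemma J_le: "J S \<le> (\<integral>s. g s \<partial>\<mu>)"
  unfolding J_def by (intro integral_mono J_integrable g_int) (simp add: g_nonneg kappa_le_1 mult_left_le)

lemma J_initial_tendsto: "(\<lambda>m. J (initial D m)) \<longlonglongrightarrow> J D"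
  unfolding J_def
proof (rule integral_dominated_convergence[OF _ _ g_int])
  show "AE s in \<mu>. (\<lambda>m. g s * \<kappa> (initial D m) s) \<longlonglongrightarrow> g s * \<kappa> D s"
    by (intro AE_I2 tendsto_mult tendsto_const kappa_initial_tendsto)
  show "AE s in \<mu>. norm (g s * \<kappa> (initial D m) s) \<le> g s" for m
    by (intro AE_I2) (simp add: abs_mult kappa_nonneg g_nonneg kappa_le_1 mult_left_le)
qed simp_all

text \<open>More competitors leave a smaller share. Almost surely \<open>G\<close> depends on the
  class only, and \<open>B\<close> has at most one index per class, so it cannot have more ties than
  \<open>S\<close>. The presence of the class of 0 prevents an empty set of ties, for which the
  share would be \<open>1 / 0 = 0\<close>.\<close>

lemma J_antimono:
  assumes B: "inj_on cl B" "cl ` B \<subseteq> cl ` S" "cl 0 \<in> cl ` B"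
  shows "J S \<le> J B"
proof -
  have "AE s in \<mu>. \<kappa> S s \<le> \<kappa> B s"
    using AE_regular
  proof eventually_elim
    case (elim s)
    then have cong: "\<And>x y. cl x = cl y \<Longrightarrow> G x s = G y s" and G0: "G 0 s = g s"
      unfolding regular_def by blast+
    show ?case
    proof (cases "(\<forall>r\<in>S. G r s \<le> g s) \<and> finite {r\<in>S. G r s = g s}")
      case False
      then have "\<kappa> S s = 0" by (auto simp: \<kappa>_def)
      then show ?thesis by (simp add: kappa_nonneg)
    next
      case True
      define TS where "TS = {r\<in>S. G r s = g s}"
      define TB where "TB = {r\<in>B. G r s = g s}"
      have le: "\<forall>r\<in>B. G r s \<le> g s"
      proof
        fix r assume "r \<in> B"
        then obtain r' where "r' \<in> S" "cl r = cl r'" using B(2) by blast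
        then show "G r s \<le> g s" using True cong[of r r'] by simp
      qed
      have sub: "cl ` TB \<subseteq> cl ` TS"
      proof
        fix c assume "c \<in> cl ` TB"
        then obtain r where r: "r \<in> B" "G r s = g s" "c = cl r" by (auto simp: TB_def)
        then obtain r' where r': "r' \<in> S" "cl r = cl r'" using B(2) by blast
        then have "r' \<in> TS" using cong[OF r'(2)] r(2) by (simp add: TS_def)
        then show "c \<in> cl ` TS" using r(3) r'(2) by blast
      qed
      have finTS: "finite TS" using True by (simp add: TS_def)
      have inj: "inj_on cl TB" using B(1) by (auto simp: TB_def inj_on_def)
      have finTB: "finite TB" using finite_subset[OF sub] finTS inj finite_imageD by blast
      have "card TB = card (cl ` TB)" by (rule card_image[OF inj, symmetric])
      also have "\<dots> \<le> card (cl ` TS)" using finTS by (intro card_mono sub) simp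
      also have "\<dots> \<le> card TS" using finTS by (rule card_image_le)
      finally have card: "card TB \<le> card TS" .
      obtain r0 where "r0 \<in> B" "cl 0 = cl r0" using B(3) by blast
      then have "r0 \<in> TB" using cong[of 0 r0] G0 by (simp add: TB_def)
      then have "0 < card TB" using finTB by (auto simp: card_gt_0_iff)
      then have "1 / real (card TS) \<le> 1 / real (card TB)" using card by (intro divide_left_mono) auto
      then show ?thesis using True le by (simp add: \<kappa>_def TS_def TB_def)
    qed
  qed
  then show ?thesis
    unfolding J_def
    by (intro integral_mono_AE J_integrable) (auto intro: mult_left_mono g_nonneg elim!: eventually_mono)
qed

section \<open>The integral of the maximum and its averages\<close>

lemma integral_translate:
  assumes [measurable]: "h \<in> borel_measurable \<mu>" and h: "\<And>s. 0 \<le> h s" "integrable \<mu> h"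
  shows "integrable \<mu> (\<lambda>s. w t s * h (\<phi> t s))" "(\<integral>s. w t s * h (\<phi> t s) \<partial>\<mu>) = (\<integral>s. h s \<partial>\<mu>)"
proof -
  have eq: "(\<integral>\<^sup>+s. ennreal (w t s * h (\<phi> t s)) \<partial>\<mu>) = (\<integral>\<^sup>+s. ennreal (h s) \<partial>\<mu>)"
    using nn_integral_change_variable[of "\<lambda>s. ennreal (h s)" t] by (simp add: ennreal_mult w_nonneg h)
  have fin: "(\<integral>\<^sup>+s. ennreal (h s) \<partial>\<mu>) < \<infinity>"
    using h by (simp add: nn_integral_eq_integral less_top)
  show "integrable \<mu> (\<lambda>s. w t s * h (\<phi> t s))"
    using eq fin by (intro integrableI_nonneg) (auto simp: w_nonneg h)
  show "(\<integral>s. w t s * h (\<phi> t s) \<partial>\<mu>) = (\<integral>s. h s \<partial>\<mu>)"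
    using eq by (simp add: integral_eq_nn_integral w_nonneg h)
qed

text \<open>Comparing \<open>G r s\<close> with \<open>G t s\<close> amounts to comparing
  \<open>G (r - t)\<close> with \<open>g\<close> at \<open>\<phi> t s\<close>, because the positive
  factor \<open>w t s\<close> is common to both. So the share of \<open>t\<close> at
  \<open>s\<close> is the share of 0 at \<open>\<phi> t s\<close> for the translated index
  set.\<close>

lemma integral_Max_eq_sum_J:
  assumes R: "finite R" "R \<noteq> {}"
  shows "(\<integral>s. Max ((\<lambda>t. G t s) ` R) \<partial>\<mu>) = (\<Sum>t\<in>R. J ((\<lambda>r. r - t) ` R))"
proof -
  have "AE s in \<mu>. Max ((\<lambda>t. G t s) ` R)
      = (\<Sum>t\<in>R. w t s * (g (\<phi> t s) * \<kappa> ((\<lambda>r. r - t) ` R) (\<phi> t s)))"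
    using AE_regular
  proof eventually_elim
    case (elim s)
    have "Max ((\<lambda>t. G t s) ` R) = (\<Sum>t\<in>R. G t s *
        (if \<forall>r\<in>R. G r s \<le> G t s then 1 / real (card {r\<in>R. G r s = G t s}) else 0))"
      by (rule Max_eq_sum_argmax[OF R])
    also have "\<dots> = (\<Sum>t\<in>R. G t s * \<kappa> ((\<lambda>r. r - t) ` R) (\<phi> t s))"
    proof (intro sum.cong refl arg_cong2[where f = "(*)"])
      fix t assume "t \<in> R"
      have pos: "0 < w t s" and shift: "G r s = w t s * G (r - t) (\<phi> t s)" for r
        using elim unfolding regular_def by (blast, metis diff_add_cancel)
      have le: "G r s \<le> G t s \<longleftrightarrow> G (r - t) (\<phi> t s) \<le> g (\<phi> t s)"
        and eq: "G r s = G t s \<longleftrightarrow> G (r - t) (\<phi> t s) = g (\<phi> t s)" for r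
        using pos by (auto simp: shift[of r] G_def[of t])
      have "{r' \<in> (\<lambda>r. r - t) ` R. G r' (\<phi> t s) = g (\<phi> t s)} = (\<lambda>r. r - t) ` {r\<in>R. G r s = G t s}"
        by (auto simp: eq)
      then have "card {r' \<in> (\<lambda>r. r - t) ` R. G r' (\<phi> t s) = g (\<phi> t s)} = card {r\<in>R. G r s = G t s}"
        by (simp add: card_image inj_on_def)
      then show "(if \<forall>r\<in>R. G r s \<le> G t s then 1 / real (card {r\<in>R. G r s = G t s}) else 0)
          = \<kappa> ((\<lambda>r. r - t) ` R) (\<phi> t s)"
        by (simp add: \<kappa>_def le)
    qed
    finally show ?case by (simp add: G_def mult.assoc)
  qed
  then have "(\<integral>s. Max ((\<lambda>t. G t s) ` R) \<partial>\<mu>)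
      = (\<integral>s. (\<Sum>t\<in>R. w t s * (g (\<phi> t s) * \<kappa> ((\<lambda>r. r - t) ` R) (\<phi> t s))) \<partial>\<mu>)"
    using R by (intro integral_cong_AE) auto
  also have "\<dots> = (\<Sum>t\<in>R. \<integral>s. w t s * (g (\<phi> t s) * \<kappa> ((\<lambda>r. r - t) ` R) (\<phi> t s)) \<partial>\<mu>)"
    by (intro Bochner_Integration.integral_sum
        integral_translate(1)[where h = "\<lambda>s. g s * \<kappa> S s" for S, simplified])
      (auto simp: g_nonneg kappa_nonneg J_integrable)
  also have "\<dots> = (\<Sum>t\<in>R. J ((\<lambda>r. r - t) ` R))"
    unfolding J_def
    by (intro sum.cong refl integral_translate(2)[where h = "\<lambda>s. g s * \<kappa> S s" for S, simplified])
      (auto simp: g_nonneg kappa_nonneg J_integrable)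
  finally show ?thesis .
qed

text \<open>Every summand is at least \<open>J D\<close>, since a translate of \<open>R n\<close>
  meets no more classes than \<open>D\<close>. Away from the boundary it meets all classes of a
  finite part \<open>B\<close> of \<open>D\<close>, so the summand is at most \<open>J B\<close>,
  which is close to \<open>J D\<close>. A boundary summand is at most the integral of
  \<open>g\<close>, and there are few of them.\<close>

lemma mean_Max_tendsto:
  assumes D: "inj_on cl D" "cl ` D = range cl" "0 \<in> D"
    and R: "\<And>n. finite (R n)" "\<And>n. inj_on cl (R n)" "\<forall>\<^sub>F n in sequentially. R n \<noteq> {}"
    and boundary: "\<And>B. finite B \<Longrightarrow>
      (\<lambda>n. real (card {t\<in>R n. \<exists>b\<in>B. cl (t + b) \<notin> cl ` R n}) / real (card (R n))) \<longlonglongrightarrow> 0"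
  shows "(\<lambda>n. (\<integral>s. Max ((\<lambda>t. G t s) ` R n) \<partial>\<mu>) / real (card (R n))) \<longlonglongrightarrow> J D"
proof (rule LIMSEQ_I)
  fix \<epsilon> :: real assume \<epsilon>: "0 < \<epsilon>"
  define c where "c = (\<integral>s. g s \<partial>\<mu>)"
  have c: "0 \<le> c" unfolding c_def by (simp add: g_nonneg)
  have "\<forall>\<^sub>F m in sequentially. J (initial D m) < J D + \<epsilon> / 2"
    using \<epsilon> by (intro order_tendstoD(2)[OF J_initial_tendsto]) simp
  then obtain m where m: "J (initial D m) < J D + \<epsilon> / 2" by (auto simp: eventually_sequentially)
  define B where "B = initial D m"
  define Bd where "Bd n = {t\<in>R n. \<exists>b\<in>B. cl (t + b) \<notin> cl ` R n}" for n
  have "(\<lambda>n. c * (real (card (Bd n)) / real (card (R n)))) \<longlonglongrightarrow> c * 0"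
    unfolding Bd_def by (intro tendsto_mult tendsto_const boundary) (simp add: B_def finite_initial)
  then have "\<forall>\<^sub>F n in sequentially. c * (real (card (Bd n)) / real (card (R n))) < \<epsilon> / 2"
    using \<epsilon> by (intro order_tendstoD(2)) auto
  with R(3) have "\<forall>\<^sub>F n in sequentially. norm ((\<integral>s. Max ((\<lambda>t. G t s) ` R n) \<partial>\<mu>) / real (card (R n)) - J D) < \<epsilon>"
  proof eventually_elim
    case (elim n)
    define h where "h = real (card (R n))"
    have h: "0 < h" using elim(1) R(1)[of n] by (simp add: h_def card_gt_0_iff)
    have shift: "inj_on cl ((\<lambda>r. r - t) ` R n)" "cl 0 \<in> cl ` (\<lambda>r. r - t) ` R n" if "t \<in> R n" for t
    proof -
      show "inj_on cl ((\<lambda>r. r - t) ` R n)"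
        using R(2)[of n] by (auto simp: inj_on_def cl_add_right_iff[of _ "- t", simplified])
      show "cl 0 \<in> cl ` (\<lambda>r. r - t) ` R n"
        using that by (intro imageI) (auto simp: image_iff)
    qed
    have lower: "J D \<le> J ((\<lambda>r. r - t) ` R n)" if "t \<in> R n" for t
      using shift[OF that] by (intro J_antimono) (auto simp: D(2))
    have upper: "J ((\<lambda>r. r - t) ` R n) \<le> J B + (if t \<in> Bd n then c else 0)" if "t \<in> R n" for t
    proof (cases "t \<in> Bd n")
      case True
      then show ?thesis using J_le[of "(\<lambda>r. r - t) ` R n"] J_nonneg[of B] by (simp add: c_def)
    next
      case False
      have "J ((\<lambda>r. r - t) ` R n) \<le> J B"
      proof (rule J_antimono)
        show "inj_on cl B" using D(1) initial_subset by (auto simp: B_def intro: inj_on_subset)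
        show "cl 0 \<in> cl ` B" using D(3) by (intro imageI) (simp add: B_def initial_def)
        show "cl ` B \<subseteq> cl ` (\<lambda>r. r - t) ` R n"
        proof
          fix x assume "x \<in> cl ` B"
          then obtain b where b: "b \<in> B" "x = cl b" by blast
          then have "cl (t + b) \<in> cl ` R n" using False that by (auto simp: Bd_def)
          then obtain r where r: "r \<in> R n" "cl (b + t) = cl r" by (auto simp: add.commute)
          then have "cl b = cl (r - t)" using cl_cong[OF r(2), of "- t"] by simp
          then show "x \<in> cl ` (\<lambda>r. r - t) ` R n" using b(2) r(1) by blast
        qed
      qed
      then show ?thesis using False by simp
    qed
    have eq: "(\<integral>s. Max ((\<lambda>t. G t s) ` R n) \<partial>\<mu>) = (\<Sum>t\<in>R n. J ((\<lambda>r. r - t) ` R n))"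
      by (rule integral_Max_eq_sum_J[OF R(1) elim(1)])
    have "(\<Sum>t\<in>R n. J D) \<le> (\<Sum>t\<in>R n. J ((\<lambda>r. r - t) ` R n))" using lower by (rule sum_mono)
    then have 1: "h * J D \<le> (\<integral>s. Max ((\<lambda>t. G t s) ` R n) \<partial>\<mu>)" by (simp add: eq h_def)
    have "(\<Sum>t\<in>R n. J ((\<lambda>r. r - t) ` R n)) \<le> (\<Sum>t\<in>R n. J B + (if t \<in> Bd n then c else 0))"
      using upper by (rule sum_mono)
    also have "\<dots> = h * J B + c * real (card (Bd n))"
      using R(1)[of n] by (simp add: sum.distrib h_def sum.If_cases Int_def)
        (simp add: Bd_def conj_assoc[symmetric] mult.commute)
    finally have 2: "(\<integral>s. Max ((\<lambda>t. G t s) ` R n) \<partial>\<mu>) \<le> h * J B + c * real (card (Bd n))" by (simp add: eq)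
    have "J D \<le> (\<integral>s. Max ((\<lambda>t. G t s) ` R n) \<partial>\<mu>) / h"
      using 1 h by (simp add: field_simps)
    moreover have "(\<integral>s. Max ((\<lambda>t. G t s) ` R n) \<partial>\<mu>) / h \<le> J B + c * (real (card (Bd n)) / h)"
      using 2 h by (simp add: field_simps)
    ultimately show ?case
      using m elim(2) unfolding B_def h_def real_norm_def abs_less_iff by linarith
  qed
  then show "\<exists>no. \<forall>n\<ge>no. norm ((\<integral>s. Max ((\<lambda>t. G t s) ` R n) \<partial>\<mu>) / real (card (R n)) - J D) < \<epsilon>"
    by (simp add: eventually_sequentially)
qed

section \<open>Conservative and dissipative actions\<close>

lemma AE_regular_phi: "AE s in \<mu>. regular s \<and> (\<forall>t. regular (\<phi> t s))"
  using AE_regular AE_phi_all[OF AE_regular] by eventually_elim simp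

text \<open>
  Where \<open>g * \<kappa> D > 0\<close> the orbit attains its maximum, finitely often modulo the kernel, so orbits
  return there finitely often. Splitting this set by the set \<open>A\<close> of return times yields wandering
  sets, as \<open>A - u = A\<close> forces \<open>u = 0\<close>.
\<close>

lemma conservative_J_eq_0:
  assumes D: "cl ` D = range cl"
    and F: "add_subgroup F" "inj_on cl F"
    and torsion_free: "\<And>A u. finite A \<Longrightarrow> A \<noteq> {} \<Longrightarrow> (\<lambda>a. a - u) ` A = A \<Longrightarrow> u = (0 :: 'g)"
    and cons: "conservative \<mu> \<phi> F"
  shows "J D = 0"
proof -
  define E where "E = {s\<in>space \<mu>. 0 < g s * \<kappa> D s}"
  define ret where "ret s = {u\<in>F. \<phi> u s \<in> E}" for s
  define W where "W A = {s\<in>E. ret s = A}" for A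
  have E_meas [measurable]: "E \<in> sets \<mu>" unfolding E_def by measurable
  have W_meas: "W A \<in> sets \<mu>" for A
  proof -
    have "W A = {s\<in>space \<mu>. s \<in> E \<and> (\<forall>u. (u \<in> F \<and> \<phi> u s \<in> E) \<longleftrightarrow> u \<in> A)}"
      using sets.sets_into_space[OF E_meas] by (auto simp: W_def ret_def)
    also have "\<dots> \<in> sets \<mu>" by measurable
    finally show ?thesis .
  qed
  have fin: "AE s in \<mu>. s \<in> E \<longrightarrow> finite (ret s)"
    using AE_regular_phi
  proof eventually_elim
    case (elim s)
    then have reg: "regular s" "\<And>t. regular (\<phi> t s)" by auto
    have pos: "\<And>v. 0 < w v s"
      and shift: "\<And>u v. G (u + v) s = w v s * G u (\<phi> v s)"
      and G0: "G 0 s = g s"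
      using reg(1) unfolding regular_def by blast+
    have cong: "G x s' = G y s'" if "regular s'" "cl x = cl y" for x y s'
      using that unfolding regular_def by blast
    \<comment> \<open>\<open>D\<close> represents every class, so a regular point of
      \<open>E\<close> maximises along its whole orbit and not merely over \<open>D\<close>.\<close>
    have max: "G t s' \<le> g s'" if "regular s'" "s' \<in> E" for t s'
    proof -
      obtain d where d: "d \<in> D" "cl t = cl d" using D by (metis imageE rangeI)
      have "\<kappa> D s' \<noteq> 0" using that(2) by (auto simp: E_def)
      then have "G d s' \<le> g s'" using d(1) unfolding \<kappa>_def by meson
      then show ?thesis using cong[OF that(1) d(2)] by simp
    qed
    show ?case
    proof
      assume s: "s \<in> E"
      then have "\<kappa> D s \<noteq> 0" by (auto simp: E_def)
      then have finT: "finite {r\<in>D. G r s = g s}" by (auto simp: \<kappa>_def split: if_splits intro: ccontr)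
      have "cl ` ret s \<subseteq> cl ` {r\<in>D. G r s = g s}"
      proof
        fix c assume "c \<in> cl ` ret s"
        then obtain u where u: "u \<in> F" "\<phi> u s \<in> E" "c = cl u" by (auto simp: ret_def)
        \<comment> \<open>Both \<open>s\<close> and \<open>\<phi> u s\<close> maximise along the
          same orbit, so each bounds the other: return times are ties.\<close>
        have "G 0 s = w u s * G (- u) (\<phi> u s)" using shift[of "- u" u] by simp
        also have "\<dots> \<le> w u s * g (\<phi> u s)"
          using max[OF reg(2) u(2)] pos[of u] by (intro mult_left_mono) auto
        finally have "G u s = g s" using max[OF reg(1) s, of u] G0 by (simp add: G_def)
        moreover obtain d where "d \<in> D" "cl u = cl d" using D by (metis imageE rangeI)
        moreover have "G u s = G d s" by (rule cong[OF reg(1)]) fact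
        ultimately show "c \<in> cl ` {r\<in>D. G r s = g s}" using u(3) by auto
      qed
      then have "finite (cl ` ret s)" using finT by (meson finite_imageI finite_subset)
      moreover have "inj_on cl (ret s)" using F(2) by (rule inj_on_subset) (auto simp: ret_def)
      ultimately show "finite (ret s)" by (rule finite_imageD)
    qed
  qed
  have "wandering \<mu> \<phi> F (W A)" if "finite A" for A
    unfolding wandering_def disjoint_family_on_def
  proof (intro conjI W_meas ballI impI)
    fix u v assume uv: "u \<in> F" "v \<in> F" "u \<noteq> v"
    show "\<phi> u ` W A \<inter> \<phi> v ` W A = {}"
    proof (rule ccontr)
      assume "\<phi> u ` W A \<inter> \<phi> v ` W A \<noteq> {}"
      then obtain s s' where s: "s \<in> W A" "s' \<in> W A" "\<phi> u s = \<phi> v s'" by auto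
      define d where "d = u - v"
      have space: "s \<in> space \<mu>" "s' \<in> space \<mu>" using s by (auto simp: W_def E_def)
      have "\<phi> (- v) (\<phi> u s) = \<phi> (- v) (\<phi> v s')" using s(3) by simp
      then have s': "s' = \<phi> d s" using space by (simp add: phi_add phi_0 d_def)
      have d: "d \<in> F" "- d \<in> F"
        using add_subgroup_diff[OF F(1)] add_subgroup_uminus[OF F(1)] uv by (auto simp: d_def)
      \<comment> \<open>Moving from \<open>s\<close> to \<open>\<phi> d s\<close> translates the
        return times by \<open>- d\<close>, yet both points have the same set \<open>A\<close> of
        return times.\<close>
      have "ret s' = (\<lambda>a. a - d) ` ret s"
      proof (intro Set.set_eqI iffI)
        fix x assume "x \<in> ret s'"
        then have "x + d \<in> ret s"
          using add_subgroup_add[OF F(1) _ d(1)] by (simp add: ret_def s' phi_add space)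
        then show "x \<in> (\<lambda>a. a - d) ` ret s" by (intro image_eqI[of _ _ "x + d"]) auto
      next
        fix x assume "x \<in> (\<lambda>a. a - d) ` ret s"
        then show "x \<in> ret s'"
          using add_subgroup_diff[OF F(1) _ d(1)] by (auto simp: ret_def s' phi_add space)
      qed
      then have "(\<lambda>a. a - d) ` A = A" using s(1,2) by (auto simp: W_def)
      moreover have "0 \<in> A"
        using s(1) space add_subgroup_zero[OF F(1)] by (auto simp: W_def ret_def phi_0)
      ultimately have "d = 0" using torsion_free[OF that] by blast
      then show False using uv(3) by (simp add: d_def)
    qed
  qed
  then have null: "emeasure \<mu> (W A) = 0" if "finite A" for A
    using that cons unfolding conservative_def by (auto simp: not_gr_zero)
  \<comment> \<open>A countable group has only countably many finite subsets, and the null sets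
    \<open>W A\<close> with \<open>A\<close> finite cover almost all of \<open>E\<close>.\<close>
  have "AE s in \<mu>. \<forall>A\<in>{A. finite A}. s \<notin> W A"
    using null W_meas by (intro AE_ball_countable[THEN iffD2] ballI AE_not_in countable_Collect_finite) auto
  with fin have "AE s in \<mu>. g s * \<kappa> D s = 0"
    using AE_space
  proof eventually_elim
    case (elim s)
    then have "s \<notin> E" by (auto simp: W_def)
    then have "\<not> 0 < g s * \<kappa> D s" using elim(3) by (simp add: E_def)
    moreover have "0 \<le> g s * \<kappa> D s" by (simp add: g_nonneg kappa_nonneg)
    ultimately show ?case by linarith
  qed
  then have "J D = (\<integral>s. 0 \<partial>\<mu>)" unfolding J_def by (intro integral_cong_AE) auto
  then show ?thesis by simp
qed

text \<open>The integral over \<open>W\<close> of the sum of all \<open>G (v + u)\<close> with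
  \<open>u\<close> in \<open>F\<close> equals the integral of \<open>G v\<close> over the disjoint
  translates of \<open>W\<close>, hence is at most the integral of \<open>g\<close>. So the sum is
  finite almost everywhere on \<open>W\<close> and only finitely many terms reach
  \<open>\<epsilon>\<close>.\<close>

lemma AE_finite_large_on_wandering:
  assumes W: "wandering \<mu> \<phi> F W" and "0 < \<epsilon>"
  shows "AE s in \<mu>. s \<in> W \<longrightarrow> finite {u\<in>F. \<epsilon> \<le> G (v + u) s}"
proof -
  have [measurable]: "W \<in> sets \<mu>" using W by (simp add: wandering_def)
  have disj: "u = u'" if "u \<in> F" "u' \<in> F" "\<phi> (- u) s \<in> W" "\<phi> (- u') s \<in> W" "s \<in> space \<mu>" for u u' s
  proof (rule ccontr)
    assume "u \<noteq> u'"
    then have "\<phi> u ` W \<inter> \<phi> u' ` W = {}"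
      using W that(1,2) unfolding wandering_def disjoint_family_on_def by blast
    moreover have "s = \<phi> u (\<phi> (- u) s)" "s = \<phi> u' (\<phi> (- u') s)"
      using that(5) by (simp_all add: phi_add phi_0)
    then have "s \<in> \<phi> u ` W" "s \<in> \<phi> u' ` W" using that(3,4) by blast+
    ultimately show False by blast
  qed
  have "(\<integral>\<^sup>+s. (\<integral>\<^sup>+u. indicator W s * ennreal (G (v + u) s) \<partial>count_space F) \<partial>\<mu>)
      = (\<integral>\<^sup>+u. (\<integral>\<^sup>+s. indicator W s * ennreal (G (v + u) s) \<partial>\<mu>) \<partial>count_space F)"
    by (rule nn_integral_count_space_nn_integral) auto
  also have "\<dots> = (\<integral>\<^sup>+u. (\<integral>\<^sup>+s. indicator W (\<phi> (- u) s) * ennreal (G v s) \<partial>\<mu>) \<partial>count_space F)"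
  proof (rule nn_integral_cong)
    fix u
    have "(\<integral>\<^sup>+s. indicator W s * ennreal (G (v + u) s) \<partial>\<mu>)
        = (\<integral>\<^sup>+s. ennreal (w u s) * (indicator W (\<phi> (- u) (\<phi> u s)) * ennreal (G v (\<phi> u s))) \<partial>\<mu>)"
      using AE_regular
    proof (intro nn_integral_cong_AE, eventually_elim)
      case (elim s)
      then have "s \<in> space \<mu>" "G (v + u) s = w u s * G v (\<phi> u s)" by (auto simp: regular_def)
      then show ?case
        by (simp add: ennreal_mult w_nonneg G_nonneg phi_add phi_0 mult.left_commute)
    qed
    also have "\<dots> = (\<integral>\<^sup>+s. indicator W (\<phi> (- u) s) * ennreal (G v s) \<partial>\<mu>)"
      by (rule nn_integral_change_variable) measurable
    finally show "(\<integral>\<^sup>+s. indicator W s * ennreal (G (v + u) s) \<partial>\<mu>)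
        = (\<integral>\<^sup>+s. indicator W (\<phi> (- u) s) * ennreal (G v s) \<partial>\<mu>)" .
  qed
  also have "\<dots> = (\<integral>\<^sup>+s. (\<integral>\<^sup>+u. indicator W (\<phi> (- u) s) * ennreal (G v s) \<partial>count_space F) \<partial>\<mu>)"
    by (rule nn_integral_count_space_nn_integral[symmetric]) auto
  also have "\<dots> \<le> (\<integral>\<^sup>+s. ennreal (G v s) \<partial>\<mu>)"
  proof (rule nn_integral_mono)
    fix s assume s: "s \<in> space \<mu>"
    define U where "U = {u\<in>F. \<phi> (- u) s \<in> W}"
    have U: "finite U" "card U \<le> 1"
    proof -
      have "\<exists>u0. U \<subseteq> {u0}" using disj s unfolding U_def by blast
      then obtain u0 where "U \<subseteq> {u0}" by blast
      then show "finite U" "card U \<le> 1" using card_mono[of "{u0}" U] finite_subset by auto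
    qed
    have "(\<integral>\<^sup>+u. indicator W (\<phi> (- u) s) * ennreal (G v s) \<partial>count_space F)
        = (\<integral>\<^sup>+u. ennreal (G v s) * indicator U u \<partial>count_space F)"
      by (intro nn_integral_cong) (auto simp: U_def indicator_def)
    also have "\<dots> = ennreal (G v s) * emeasure (count_space F) U"
      by (rule nn_integral_cmult_indicator) (auto simp: U_def)
    also have "emeasure (count_space F) U = of_nat (card U)"
      using U(1) by (intro emeasure_count_space_finite) (auto simp: U_def)
    also have "ennreal (G v s) * of_nat (card U) \<le> ennreal (G v s) * 1"
      using U(2) by (intro mult_left_mono) (auto simp: of_nat_le_1_iff)
    finally show "(\<integral>\<^sup>+u. indicator W (\<phi> (- u) s) * ennreal (G v s) \<partial>count_space F) \<le> ennreal (G v s)"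
      by simp
  qed
  also have "\<dots> = (\<integral>\<^sup>+s. ennreal (g s) \<partial>\<mu>)"
    using nn_integral_change_variable[of "\<lambda>s. ennreal (g s)" v]
    by (simp add: G_def ennreal_mult w_nonneg g_nonneg)
  also have "\<dots> < \<infinity>"
    using g_int g_nonneg by (simp add: nn_integral_eq_integral less_top)
  finally have "(\<integral>\<^sup>+s. (\<integral>\<^sup>+u. indicator W s * ennreal (G (v + u) s) \<partial>count_space F) \<partial>\<mu>) \<noteq> \<infinity>"
    by (simp add: less_top)
  \<comment> \<open>\<open>F\<close> is countable, so measurability in \<open>s\<close> for each
    \<open>u\<close> is enough for joint measurability.\<close>
  moreover have "(\<lambda>s. \<integral>\<^sup>+u. indicator W s * ennreal (G (v + u) s) \<partial>count_space F) \<in> borel_measurable \<mu>"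
  proof (rule sigma_finite_measure.borel_measurable_nn_integral[OF sigma_finite_measure_count_space])
    have "(\<lambda>(u, s). indicator W s * ennreal (G (v + u) s)) \<in> borel_measurable (count_space F \<Otimes>\<^sub>M \<mu>)"
      by (rule measurable_pair_measure_countable1) auto
    then show "(\<lambda>(s, u). indicator W s * ennreal (G (v + u) s)) \<in> borel_measurable (\<mu> \<Otimes>\<^sub>M count_space F)"
      by (subst measurable_pair_swap_iff) (simp add: case_prod_unfold)
  qed
  ultimately have "AE s in \<mu>. (\<integral>\<^sup>+u. indicator W s * ennreal (G (v + u) s) \<partial>count_space F) \<noteq> \<infinity>"
    by (rule nn_integral_noteq_infinite[rotated])
  then show ?thesis
  proof eventually_elim
    case (elim s)
    show ?case
    proof (rule impI, rule ccontr)
      assume s: "s \<in> W" "infinite {u\<in>F. \<epsilon> \<le> G (v + u) s}"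
      let ?U = "{u\<in>F. \<epsilon> \<le> G (v + u) s}"
      have "emeasure (count_space F) ?U = \<infinity>"
        by (rule emeasure_count_space_infinite[OF _ s(2)]) blast
      then have "\<infinity> = ennreal \<epsilon> * emeasure (count_space F) ?U"
        using \<open>0 < \<epsilon>\<close> by (simp add: ennreal_mult_top)
      also have "\<dots> = (\<integral>\<^sup>+u. ennreal \<epsilon> * indicator ?U u \<partial>count_space F)"
        by (rule nn_integral_cmult_indicator[symmetric]) auto
      also have "\<dots> \<le> (\<integral>\<^sup>+u. indicator W s * ennreal (G (v + u) s) \<partial>count_space F)"
        using s(1) by (intro nn_integral_mono) (auto simp: indicator_def ennreal_leI)
      finally show False using elim by (simp add: top.extremum_unique)
    qed
  qed
qed

text \<open>If \<open>J D = 0\<close>, then \<open>g * \<kappa> D\<close> vanishes along almost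
  every orbit. But for almost every point of \<open>W\<close> only finitely many classes exceed a
  given positive threshold, so the orbit contains a maximiser with finitely many ties, where the
  product is positive. Thus \<open>W\<close> is null, although its translates cover almost all of
  the space.\<close>

lemma dissipative_J_pos:
  assumes D: "inj_on cl D" "cl ` D = range cl" "0 \<in> D"
    and N: "finite N" "\<And>t. \<exists>u\<in>F. \<exists>v\<in>N. cl t = cl (v + u)"
    and diss: "dissipative \<mu> \<phi> F"
    and support: "AE s in \<mu>. \<exists>t. 0 < G t s" and nontrivial: "emeasure \<mu> (space \<mu>) \<noteq> 0"
  shows "0 < J D"
proof (rule ccontr)
  assume "\<not> 0 < J D"
  then have "J D = 0" using J_nonneg[of D] by simp
  then have "AE s in \<mu>. g s * \<kappa> D s = 0"
    unfolding J_def
    by (subst (asm) integral_nonneg_eq_0_iff_AE[OF J_integrable]) (auto simp: g_nonneg kappa_nonneg)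
  then have zero: "AE s in \<mu>. \<forall>t. g (\<phi> t s) * \<kappa> D (\<phi> t s) = 0" by (rule AE_phi_all)
  obtain W where W: "wandering \<mu> \<phi> F W" "AE s in \<mu>. s \<in> (\<Union>t\<in>F. \<phi> t ` W)"
    using diss by (auto simp: dissipative_def)
  have fin: "AE s in \<mu>. s \<in> W \<longrightarrow> (\<forall>k. \<forall>v\<in>N. finite {u\<in>F. 1 / real (Suc k) \<le> G (v + u) s})"
  proof -
    have "AE s in \<mu>. \<forall>k v. s \<in> W \<longrightarrow> finite {u\<in>F. 1 / real (Suc k) \<le> G (v + u) s}"
      unfolding AE_all_countable by (intro allI AE_finite_large_on_wandering[OF W(1)]) simp
    then show ?thesis by eventually_elim blast
  qed
  have notW: "AE s in \<mu>. s \<notin> W"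
    using AE_regular_phi zero fin support
  proof eventually_elim
    case (elim s)
    have pos: "\<And>v. 0 < w v s"
      and shift: "\<And>u v. G (u + v) s = w v s * G u (\<phi> v s)"
      using elim(1) unfolding regular_def by blast+
    have cong: "G x s = G y s" if "cl x = cl y" for x y
      using that elim(1) unfolding regular_def by blast
    show ?case
    proof
      assume s: "s \<in> W"
      obtain t0 where t0: "0 < G t0 s" using elim(4) by blast
      \<comment> \<open>The threshold lies below a value that is attained, so that the set
        \<open>T\<close> below is nonempty.\<close>
      obtain k where k: "1 / real (Suc k) < G t0 s" using nat_approx_posE[OF t0] by blast
      define e where "e = 1 / real (Suc k)"
      have finU: "finite {u\<in>F. e \<le> G (v + u) s}" if "v \<in> N" for v
        using elim(3) s that unfolding e_def by blast
      have rep: "\<exists>d\<in>D. cl t = cl d" for t using D(2) by (metis imageE rangeI)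
      define T where "T = {d\<in>D. e \<le> G d s}"
      \<comment> \<open>Every class is that of some \<open>v + u\<close> with \<open>v\<close> in
        the finite set \<open>N\<close> and \<open>u\<close> in \<open>F\<close>, so finiteness for
        each \<open>v\<close> suffices.\<close>
      have "cl ` T \<subseteq> (\<Union>v\<in>N. (\<lambda>u. cl (v + u)) ` {u\<in>F. e \<le> G (v + u) s})"
      proof
        fix c assume "c \<in> cl ` T"
        then obtain d where d: "d \<in> D" "e \<le> G d s" "c = cl d" by (auto simp: T_def)
        obtain u v where uv: "u \<in> F" "v \<in> N" "cl d = cl (v + u)" using N(2) by blast
        then have "e \<le> G (v + u) s" using cong[OF uv(3)] d(2) by simp
        then show "c \<in> (\<Union>v\<in>N. (\<lambda>u. cl (v + u)) ` {u\<in>F. e \<le> G (v + u) s})" using uv d(3) by blast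
      qed
      then have finclT: "finite (cl ` T)"
        using N(1) finU by (meson finite_UN_I finite_imageI finite_subset)
      moreover have injT: "inj_on cl T" using D(1) by (rule inj_on_subset) (auto simp: T_def)
      ultimately have finT: "finite T" by (rule finite_imageD)
      obtain t1 where t1: "t1 \<in> D" "cl t0 = cl t1" using rep by blast
      then have "t1 \<in> T" using k cong[OF t1(2)] by (simp add: T_def e_def)
      then have "Max ((\<lambda>d. G d s) ` T) \<in> (\<lambda>d. G d s) ` T" using finT by (intro Max_in) auto
      then obtain t where t: "t \<in> T" "G t s = Max ((\<lambda>d. G d s) ` T)" by auto
      have e0: "0 < e" by (simp add: e_def)
      have Gt: "e \<le> G t s" using t(1) by (simp add: T_def)
      have maxD: "G d s \<le> G t s" if "d \<in> D" for d
      proof (cases "d \<in> T")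
        case True
        then show ?thesis using finT t(2) by simp
      next
        case False
        then show ?thesis using that Gt by (simp add: T_def)
      qed
      have max: "G r s \<le> G t s" for r
      proof -
        obtain d where d: "d \<in> D" "cl r = cl d" using rep by blast
        then show ?thesis using maxD[OF d(1)] cong[OF d(2)] by simp
      qed
      \<comment> \<open>Seen from the maximiser \<open>s'\<close>, the index 0 takes the place of
        \<open>t\<close>, and positivity of \<open>w t s\<close> preserves all comparisons.\<close>
      define s' where "s' = \<phi> t s"
      have g': "G t s = w t s * g s'" by (simp add: G_def s'_def)
      have shift': "G (r + t) s = w t s * G r s'" for r by (simp add: shift s'_def)
      have "\<forall>r\<in>D. G r s' \<le> g s'"
      proof
        fix r show "G r s' \<le> g s'" using max[of "r + t"] pos[of t] by (simp add: shift' g')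
      qed
      moreover define T' where "T' = {r\<in>D. G r s' = g s'}"
      have "finite T'"
      proof -
        \<comment> \<open>Translation by \<open>t\<close> turns ties at \<open>s'\<close> into
          maximisers at \<open>s\<close>, whose classes are represented in \<open>T\<close>.\<close>
        have "(\<lambda>r. cl (r + t)) ` T' \<subseteq> cl ` T"
        proof
          fix c assume "c \<in> (\<lambda>r. cl (r + t)) ` T'"
          then obtain r where r: "r \<in> D" "G r s' = g s'" "c = cl (r + t)" by (auto simp: T'_def)
          have "G (r + t) s = G t s" by (simp add: shift' g' r(2))
          moreover obtain d where d: "d \<in> D" "cl (r + t) = cl d" using rep by blast
          ultimately have "d \<in> T" using cong[OF d(2)] Gt by (simp add: T_def)
          then show "c \<in> cl ` T" using d(2) r(3) by blast
        qed
        then have "finite ((\<lambda>r. cl (r + t)) ` T')" using finclT finite_subset by blast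
        moreover have "inj_on (\<lambda>r. cl (r + t)) T'"
          using D(1) by (auto simp: inj_on_def cl_add_right_iff T'_def)
        ultimately show ?thesis by (rule finite_imageD)
      qed
      moreover have "0 \<in> T'"
      proof -
        have "G 0 s' = g s'" using elim(1) unfolding regular_def s'_def by blast
        then show ?thesis using D(3) by (simp add: T'_def)
      qed
      ultimately have "0 < \<kappa> D s'" unfolding \<kappa>_def T'_def by (auto simp: card_gt_0_iff)
      moreover have "0 < g s'"
        using Gt e0 pos[of t] g_nonneg[of s'] by (auto simp: g' order_le_less)
      moreover have "g s' * \<kappa> D s' = 0" using elim(2) by (simp add: s'_def)
      ultimately show False by simp
    qed
  qed
  \<comment> \<open>Almost every \<open>s\<close> has the form \<open>\<phi> t r\<close> with
    \<open>r\<close> in \<open>W\<close>, whereas almost no orbit meets \<open>W\<close>.\<close>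
  have "AE s in \<mu>. False"
    using W(2) AE_phi_all[OF notW] AE_space
  proof eventually_elim
    case (elim s)
    then obtain t r where "r \<in> W" "s = \<phi> t r" by blast
    moreover have "r \<in> space \<mu>"
      using \<open>r \<in> W\<close> W(1) sets.sets_into_space by (auto simp: wandering_def)
    ultimately have "\<phi> (- t) s \<in> W" by (simp add: phi_add phi_0)
    then show ?case using elim(2) by blast
  qed
  then have "emeasure \<mu> (space \<mu>) = 0" by (simp add: AE_iff_null null_setsD1)
  then show False using nontrivial by simp
qed

end

section \<open>The random field\<close>

text \<open>A null control measure gives every integral the characteristic function 1, so by
  uniqueness its law is the point mass at 0; equality of the one-dimensional marginals carries this
  to \<open>X t\<close>.\<close>

lemma AE_eq_0_if_null_control:
  assumes repr: "integral_representation P X Q M \<mu> \<alpha> f" and X: "\<And>t. X t \<in> borel_measurable P"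
    and null: "emeasure \<mu> (space \<mu>) = 0"
  shows "AE \<omega> in P. X t \<omega> = 0"
proof -
  obtain Y where Y: "\<And>t. has_stoch_integral Q \<mu> \<alpha> M (f t) (Y t)" and fdd: "same_fdd P X Q Y"
    and srm: "sas_random_measure Q \<mu> \<alpha> M"
    using repr by (auto simp: integral_representation_def)
  have Q: "prob_space Q" using srm by (simp add: sas_random_measure_def independently_scattered_def)
  have Ym [measurable]: "Y t \<in> borel_measurable Q" for t using Y by (auto simp: has_stoch_integral_def)
  note X [measurable]
  have "AE s in \<mu>. False" using null by (auto intro: AE_I[of _ _ "space \<mu>"])
  then have "(\<integral>s. \<bar>f t s\<bar> powr \<alpha> \<partial>\<mu>) = 0" by (intro integral_eq_zero_AE) auto
  then have "char (distr Q borel (Y t)) \<theta> = 1" for \<theta>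
    using srm Y[of t] by (simp add: sas_random_measure_def)
  moreover have "char (return borel 0) \<theta> = 1" for \<theta> :: real
    by (simp add: char_def integral_return)
  ultimately have "char (distr Q borel (Y t)) = char (return borel 0)" by (simp add: fun_eq_iff)
  then have "distr Q borel (Y t) = return borel 0"
    using prob_space.prob_space_distr[OF Q Ym]
    by (intro Levy_uniqueness)
      (auto simp: real_distribution_def real_distribution_axioms_def prob_space_return)
  also have "distr Q borel (Y t) = distr (distr Q (Pi\<^sub>M {t} (\<lambda>_. borel)) (\<lambda>\<omega>. \<lambda>t\<in>{t}. Y t \<omega>)) borel (\<lambda>x. x t)"
    by (subst distr_distr) (auto simp: o_def)
  also have "\<dots> = distr (distr P (Pi\<^sub>M {t} (\<lambda>_. borel)) (\<lambda>\<omega>. \<lambda>t\<in>{t}. X t \<omega>)) borel (\<lambda>x. x t)"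
    using fdd by (simp add: same_fdd_def)
  also have "\<dots> = distr P borel (X t)"
    by (subst distr_distr) (auto simp: o_def)
  finally have law: "distr P borel (X t) = return borel 0" .
  have "AE x in distr P borel (X t). x = 0" unfolding law by (subst AE_return) auto
  then show ?thesis by (subst (asm) AE_distr_iff) auto
qed

text \<open>Otherwise every linear combination of the field vanishes almost surely, and constants
  count as Gaussian.\<close>

lemma control_measure_nontrivial:
  assumes "sas_field P \<alpha> X" "\<not> gaussian_field P X" "integral_representation P X Q M \<mu> \<alpha> f"
  shows "emeasure \<mu> (space \<mu>) \<noteq> 0"
proof
  assume null: "emeasure \<mu> (space \<mu>) = 0"
  have rf: "random_field P X" using assms(1) by (simp add: sas_field_def)
  then have zero: "AE \<omega> in P. X t \<omega> = 0" for t
    using AE_eq_0_if_null_control[OF assms(3) _ null] by (auto simp: random_field_def)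
  have "gaussian_variable P (\<lambda>\<omega>. \<Sum>t\<in>J. a t * X t \<omega>)" if "finite J" for J and a :: "'b \<Rightarrow> real"
  proof -
    have "AE \<omega> in P. \<forall>t\<in>J. X t \<omega> = 0" using that zero by (intro AE_finite_allI)
    then have "AE \<omega> in P. (\<Sum>t\<in>J. a t * X t \<omega>) = 0" by eventually_elim simp
    then show ?thesis unfolding gaussian_variable_def by blast
  qed
  then have "gaussian_field P X" using rf by (simp add: gaussian_field_def)
  then show False using assms(2) by contradiction
qed

text \<open>Subtracting \<open>u\<close> permutes the finite set and lowers the sum of its elements
  by \<open>card A\<close> times \<open>u\<close>, which must therefore be 0.\<close>

lemma vec_int_torsion_free:
  fixes u :: "int ^ 'd"
  assumes "finite A" "A \<noteq> {}" "(\<lambda>a. a - u) ` A = A"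
  shows "u = 0"
proof -
  have "(\<Sum>a\<in>A. a) = (\<Sum>a\<in>(\<lambda>a. a - u) ` A. a)" using assms(3) by simp
  also have "\<dots> = (\<Sum>a\<in>A. a - u)" by (subst sum.reindex) (auto simp: inj_on_def)
  finally have "(\<Sum>a\<in>A. u) = 0" by (simp add: sum_subtractf)
  then have "(\<Sum>a\<in>A. u $ i) = 0" for i
    by (simp only: sum_component[symmetric] zero_index)
  then show ?thesis using assms(1,2) by (simp add: vec_eq_iff card_eq_0_iff)
qed

lemma abs_action_kernel_powr:
  assumes "sign_cocycle \<mu> \<phi> c" "0 < \<alpha>" "s \<in> space \<mu>"
  shows "\<bar>action_kernel \<mu> \<alpha> \<phi> c f t s\<bar> powr \<alpha> =
    enn2real (RN_deriv \<mu> (meas_comp \<mu> (\<phi> t)) s) * \<bar>f (\<phi> t s)\<bar> powr \<alpha>"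
proof -
  have "c t s \<in> {- 1, 1}" using assms(1,3) by (simp add: sign_cocycle_def)
  then have "\<bar>c t s\<bar> = 1" by auto
  then show ?thesis
    using assms(2) by (simp add: action_kernel_def abs_mult powr_mult powr_powr)
qed

theorem proposition5p1:
  fixes \<alpha> :: real
    and P :: "'w measure" and X :: "int ^ 'd \<Rightarrow> 'w \<Rightarrow> real"
    and Q :: "'v measure" and M :: "'s set \<Rightarrow> 'v \<Rightarrow> real"
    and \<mu> :: "'s measure" and f :: "'s \<Rightarrow> real"
    and \<phi> :: "int ^ 'd \<Rightarrow> 's \<Rightarrow> 's" and c :: "int ^ 'd \<Rightarrow> 's \<Rightarrow> real"
    and ft :: "int ^ 'd \<Rightarrow> 's \<Rightarrow> real" and b :: "nat \<Rightarrow> real"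
    and F :: "(int ^ 'd) set" and p :: nat
  defines "ft \<equiv> action_kernel \<mu> \<alpha> \<phi> c f"
    and "b \<equiv> max_scale \<mu> \<alpha> ft"
  assumes "0 < \<alpha>" and "\<alpha> < 2"
    and "sas_field P \<alpha> X" and "stationary_field P X" and "\<not> gaussian_field P X"
    and "nonsingular_action \<mu> \<phi>" and "sign_cocycle \<mu> \<phi> c" and "f \<in> Lalpha \<mu> \<alpha>"
    and "integral_representation P X Q M \<mu> \<alpha> ft" and "full_support \<mu> ft"
    and "effective_free_subgroup \<mu> \<phi> F p" and "1 \<le> p"
  shows "(conservative \<mu> \<phi> F \<longrightarrow>
            (\<lambda>n. real n powr (- (real p / \<alpha>)) * b n) \<longlonglongrightarrow> 0) \<and>
         (dissipative \<mu> \<phi> F \<longrightarrow>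
            (\<exists>a>0. (\<lambda>n. real n powr (- (real p / \<alpha>)) * b n) \<longlonglongrightarrow> a))"
proof -
  define g where "g s = \<bar>f s\<bar> powr \<alpha>" for s
  have f_meas [measurable]: "f \<in> borel_measurable \<mu>" and g_int: "integrable \<mu> g"
    using \<open>f \<in> Lalpha \<mu> \<alpha>\<close> by (auto simp: Lalpha_def g_def [abs_def])
  interpret sigma_finite_measure \<mu>
    using \<open>integral_representation P X Q M \<mu> \<alpha> ft\<close> by (simp add: integral_representation_def)
  interpret weighted_action \<mu> \<phi> g
    by unfold_locales (use \<open>nonsingular_action \<mu> \<phi>\<close> g_int in \<open>auto simp: g_def [abs_def]\<close>)
  have ft_G: "\<bar>ft t s\<bar> powr \<alpha> = G t s" if "s \<in> space \<mu>" for t s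
    using abs_action_kernel_powr[OF \<open>sign_cocycle \<mu> \<phi> c\<close> \<open>0 < \<alpha>\<close> that]
    by (simp add: ft_def G_def w_def g_def)
  obtain K V a where lq: "lattice_quotient cl K V a p" and F: "F = range (lin_comb p a)"
    using effective_free_subgroup_lattice[OF \<open>nonsingular_action \<mu> \<phi>\<close> \<open>effective_free_subgroup \<mu> \<phi> F p\<close>]
    unfolding cl_def [abs_def, symmetric] by blast
  interpret quot: lattice_quotient cl K V a p by (rule lq)
  have "\<exists>U\<subseteq>grid n. inj_on cl U \<and> cl ` grid n = cl ` U" for n
    using subset_image_inj[of "cl ` grid n" cl "grid n"] by blast
  then obtain R where R: "\<And>n. R n \<subseteq> grid n" "\<And>n. inj_on cl (R n)" "\<And>n. cl ` R n = cl ` grid n"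
    by metis
  have finR: "finite (R n)" for n using R(1) finite_grid finite_subset by blast
  have zero_grid: "0 \<in> grid n" if "1 \<le> n" for n using that by (simp add: mem_grid)
  have R_ne: "R n \<noteq> {}" if "1 \<le> n" for n using zero_grid[OF that] R(3)[of n] by blast
  \<comment> \<open>A full set of representatives containing 0: the other classes are represented
    first, then 0 is added.\<close>
  obtain D where D: "inj_on cl D" "cl ` D = range cl" "0 \<in> D"
  proof -
    define Z where "Z = {t. cl t \<noteq> cl 0}"
    from subset_image_inj[where S = "cl ` Z" and f = cl and T = Z, THEN iffD1, OF subset_refl]
    obtain D0 where D0: "D0 \<subseteq> Z" "inj_on cl D0" "cl ` Z = cl ` D0"
      by (elim exE conjE) (rule that)
    have "cl 0 \<notin> cl ` D0"
    proof
      assume "cl 0 \<in> cl ` D0"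
      then obtain d where "d \<in> D0" "cl 0 = cl d" by blast
      then show False using D0(1) by (auto simp: Z_def)
    qed
    then have "inj_on cl (insert 0 D0)" using D0(2) by auto
    moreover have "cl ` insert 0 D0 = range cl"
    proof
      show "range cl \<subseteq> cl ` insert 0 D0"
      proof
        fix x assume "x \<in> range cl"
        then obtain t where t: "x = cl t" by blast
        show "x \<in> cl ` insert 0 D0"
        proof (cases "t \<in> Z")
          case True
          then have "cl t \<in> cl ` D0" using D0(3) by blast
          then show ?thesis using t by blast
        next
          case False
          then show ?thesis using t by (simp add: Z_def)
        qed
      qed
    qed blast
    ultimately show ?thesis using that[of "insert 0 D0"] by simp
  qed
  define I where "I n = (\<integral>s. Max ((\<lambda>t. G t s) ` R n) \<partial>\<mu>)" for n
  \<comment> \<open>At regular points the maximum over the box depends only on the classes met, so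
    it can be taken over \<open>R n\<close>. For \<open>n = 0\<close> the box is empty, hence the
    restriction.\<close>
  have b_eq: "b n = I n powr (1 / \<alpha>)" if n: "1 \<le> n" for n
  proof -
    have "(\<integral>s. (MAX t\<in>grid n. \<bar>ft t s\<bar> powr \<alpha>) \<partial>\<mu>) = I n"
      unfolding I_def
    proof (rule integral_cong_AE)
      show "AE s in \<mu>. (MAX t\<in>grid n. \<bar>ft t s\<bar> powr \<alpha>) = Max ((\<lambda>t. G t s) ` R n)"
        using AE_regular
      proof eventually_elim
        case (elim s)
        then have "s \<in> space \<mu>" and cong: "\<And>x y. cl x = cl y \<Longrightarrow> G x s = G y s"
          unfolding regular_def by blast+
        have "(\<lambda>t. \<bar>ft t s\<bar> powr \<alpha>) ` grid n = (\<lambda>t. G t s) ` grid n"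
          using ft_G[OF \<open>s \<in> space \<mu>\<close>] by simp
        also have "\<dots> = (\<lambda>t. G t s) ` R n"
        proof
          show "(\<lambda>t. G t s) ` grid n \<subseteq> (\<lambda>t. G t s) ` R n"
          proof
            fix y assume "y \<in> (\<lambda>t. G t s) ` grid n"
            then obtain t where t: "t \<in> grid n" "y = G t s" by blast
            then have "cl t \<in> cl ` R n" using R(3) by blast
            then obtain r where "r \<in> R n" "cl t = cl r" by blast
            then show "y \<in> (\<lambda>t. G t s) ` R n" using cong[of t r] t(2) by blast
          qed
        qed (use R(1) in blast)
        finally show ?case by simp
      qed
      have "(\<lambda>s. MAX t\<in>grid n. \<bar>ft t s\<bar> powr \<alpha>) \<in> borel_measurable \<mu> \<longleftrightarrow>
          (\<lambda>s. MAX t\<in>grid n. G t s) \<in> borel_measurable \<mu>"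
        by (rule measurable_cong) (simp add: ft_G)
      then show "(\<lambda>s. MAX t\<in>grid n. \<bar>ft t s\<bar> powr \<alpha>) \<in> borel_measurable \<mu>"
        using finite_grid zero_grid[OF n] by auto
      show "(\<lambda>s. Max ((\<lambda>t. G t s) ` R n)) \<in> borel_measurable \<mu>"
        using finR by auto
    qed
    then show ?thesis by (simp add: b_def max_scale_def grid_def)
  qed
  obtain L where L: "0 < L" "(\<lambda>n. real (card (cl ` grid n)) / real n ^ p) \<longlonglongrightarrow> L"
    using quot.card_image_grid_asymp by blast
  have cardR: "card (R n) = card (cl ` grid n)" for n
    using card_image[OF R(2)[of n]] R(3)[of n] by simp
  have mean: "(\<lambda>n. I n / real (card (R n))) \<longlonglongrightarrow> J D"
    unfolding I_def
  proof (rule mean_Max_tendsto[OF D finR R(2)])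
    show "\<forall>\<^sub>F n in sequentially. R n \<noteq> {}"
      using eventually_ge_at_top[of 1] by eventually_elim (rule R_ne)
    show "(\<lambda>n. real (card {t \<in> R n. \<exists>b\<in>B. cl (t + b) \<notin> cl ` R n}) / real (card (R n))) \<longlonglongrightarrow> 0"
      if "finite B" for B
      using quot.boundary_negligible[of R B, OF R that] by (simp add: R(3))
  qed
  \<comment> \<open>The average per class tends to \<open>J D\<close>, and the number of classes is
    asymptotic to \<open>L * n ^ p\<close>.\<close>
  have I_lim: "(\<lambda>n. I n / real n ^ p) \<longlonglongrightarrow> J D * L"
  proof (rule Lim_transform_eventually)
    show "(\<lambda>n. I n / real (card (R n)) * (real (card (cl ` grid n)) / real n ^ p)) \<longlonglongrightarrow> J D * L"
      by (intro tendsto_mult mean L(2))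
    show "\<forall>\<^sub>F n in sequentially. I n / real (card (R n)) * (real (card (cl ` grid n)) / real n ^ p) = I n / real n ^ p"
      using eventually_ge_at_top[of 1]
    proof eventually_elim
      case (elim n)
      then have "card (R n) \<noteq> 0" using R_ne finR by simp
      then show ?case by (simp add: cardR)
    qed
  qed
  have I_nonneg: "0 \<le> I n" if n: "1 \<le> n" for n
    unfolding I_def
  proof (rule integral_nonneg_AE, rule AE_I2)
    fix s
    obtain r where "r \<in> R n" using R_ne[OF n] by blast
    then have "G r s \<le> Max ((\<lambda>t. G t s) ` R n)" using finR by (intro Max_ge) auto
    then show "0 \<le> Max ((\<lambda>t. G t s) ` R n)" using G_nonneg[of r s] by linarith
  qed
  \<comment> \<open>In the conservative case the inner limit is 0, where passing to the power
    \<open>1 / \<alpha>\<close> requires a positive exponent and eventually nonnegative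
    terms.\<close>
  have lim: "(\<lambda>n. real n powr (- (real p / \<alpha>)) * b n) \<longlonglongrightarrow> (J D * L) powr (1 / \<alpha>)"
  proof (rule Lim_transform_eventually)
    have "\<forall>\<^sub>F n in sequentially. 0 \<le> I n / real n ^ p"
      using eventually_ge_at_top[of 1] by eventually_elim (simp add: I_nonneg)
    then show "(\<lambda>n. (I n / real n ^ p) powr (1 / \<alpha>)) \<longlonglongrightarrow> (J D * L) powr (1 / \<alpha>)"
      using \<open>0 < \<alpha>\<close> by (intro tendsto_powr' I_lim tendsto_const) auto
    show "\<forall>\<^sub>F n in sequentially. (I n / real n ^ p) powr (1 / \<alpha>) = real n powr (- (real p / \<alpha>)) * b n"
      using eventually_ge_at_top[of 1]
    proof eventually_elim
      case (elim n)
      then have "(real n ^ p) powr (1 / \<alpha>) = real n powr (real p / \<alpha>)"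
        by (simp add: powr_powr flip: powr_realpow)
      then show ?case
        using elim I_nonneg[OF elim] by (simp add: b_eq powr_divide powr_minus field_simps)
    qed
  qed
  show ?thesis
  proof (intro conjI impI)
    assume "conservative \<mu> \<phi> F"
    then have "J D = 0"
      using quot.add_subgroup_range_lin_comb quot.inj_on_range_lin_comb vec_int_torsion_free
      by (intro conservative_J_eq_0[OF D(2)]) (auto simp: F)
    then show "(\<lambda>n. real n powr (- (real p / \<alpha>)) * b n) \<longlonglongrightarrow> 0" using lim by simp
  next
    assume diss: "dissipative \<mu> \<phi> F"
    obtain N where N: "finite N" "\<And>t. \<exists>m. \<exists>v\<in>N. cl t = cl (lin_comb p a m + v)"
      using quot.ex_finite_torsion_reps by blast
    have "0 < J D"
    proof (rule dissipative_J_pos[OF D N(1) _ diss])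
      show "\<exists>u\<in>F. \<exists>v\<in>N. cl t = cl (v + u)" for t
        using N(2)[of t] by (auto simp: F add.commute)
      show "AE s in \<mu>. \<exists>t. 0 < G t s"
        using \<open>full_support \<mu> ft\<close>[unfolded full_support_def] AE_space
      proof eventually_elim
        case (elim s)
        then obtain t where "ft t s \<noteq> 0" by blast
        then have "0 < \<bar>ft t s\<bar> powr \<alpha>" by simp
        then show ?case using ft_G[OF elim(2)] by auto
      qed
      show "emeasure \<mu> (space \<mu>) \<noteq> 0"
        by (rule control_measure_nontrivial) fact+
    qed
    then have "0 < (J D * L) powr (1 / \<alpha>)" using L(1) by simp
    then show "\<exists>a>0. (\<lambda>n. real n powr (- (real p / \<alpha>)) * b n) \<longlonglongrightarrow> a" using lim by blast
  qed
qed

end
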